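(* Let $\mathcal{G}$ be a finite connected groupoid with object set $\mathcal{G}_0$, let $x\in\mathcal{G}_0$, and let $\alpha=(A_g,\alpha_g)_{g\in\mathcal{G}}$ be a unital group-type partial action of $\mathcal{G}$ on a ring $A=\bigoplus_{y\in\mathcal{G}_0}A_y$. Let $\tau(x)=\{\tau_y : y\in\mathcal{G}_0\}$ be a transversal for $x$ with $A_{\tau_y^{-1}}=A_x$ and $A_{\tau_y}=A_y$ for all $y\in\mathcal{G}_0$. Let $\alpha_{(x)}=(A_h,\alpha_h)_{h\in\mathcal{G}(x)}$ be the induced partial action of the isotropy group $\mathcal{G}(x)$ on $A_x$. Then: (i) if $A_x\subset A_x\star_{\alpha_{(x)}}\mathcal{G}(x)$ is a separable extension and there exists $a\in C(A)$ such that $\sum_{z\in\mathcal{G}_0}\alpha_{\tau_z^{-1}}(a1_z)=1_x$, then $A\subset A\star_\alpha\mathcal{G}$ is a separable extension; (ii) if $A\subset A\star_\alpha\mathcal{G}$ is a separable extension, then $A_x\subset A_x\star_{\alpha_{(x)}}\mathcal{G}(x)$ is a separable extension.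
   Context: Rings are associative, not necessarily unital; $C(A)$ is the center of $A$. A groupoid is a small category in which every morphism is invertible; for $g:x\to y$ write $s(g)=x$, $t(g)=y$; objects are identified with their identity morphisms; $gh$ is defined iff $s(g)=t(h)$. $\mathcal{G}(x)=\{g : s(g)=t(g)=x\}$. $\mathcal{G}$ is connected if any two objects are joined by a morphism. A partial action of $\mathcal{G}$ on a ring $A$ is a family $\alpha=(A_g,\alpha_g)_{g\in\mathcal{G}}$ such that: (i) $A_g$ is an ideal of $A_{t(g)}$ and $A_{t(g)}$ is an ideal of $A$ for all $g$; (ii) $\alpha_g:A_{g^{-1}}\to A_g$ is a ring isomorphism; (iii) $\alpha_y=\mathrm{id}_{A_y}$ for each object $y$; (iv) $\alpha_{gh}$ extends $\alpha_g\alpha_h$ (defined on $\alpha_h^{-1}(A_{g^{-1}}\cap A_h)$) whenever $s(g)=t(h)$. It is unital if for each $g$ there is a central idempotent $1_g$ of $A$ with $A_g=A1_g$. A group is viewed as a groupoid with one object. A transversal for $x$ is a family $\tau(x)=\{\tau_y\}_{y\in\mathcal{G}_0}$ of morphisms $\tau_y:x\to y$ with $\tau_x=x$. A partial action $\alpha$ of a connected groupoid is group-type if for some object $x$ there is a transversal $\{\tau_y\}$ for $x$ with $A_{\tau_y^{-1}}=A_x$ and $A_{\tau_y}=A_y$ for all $y$ (this does not depend on the choice of $x$). For a unital partial action, the partial skew groupoid ring $A\star_\alpha\mathcal{G}$ is the set of finite formal sums $\sum_g a_g\delta_g$, $a_g\in A_g$, with componentwise addition and $(a_g\delta_g)(a_h\delta_h)=a_g\alpha_g(a_h1_{g^{-1}})\delta_{gh}$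 if $s(g)=t(h)$ and $0$ otherwise. When $\mathcal{G}_0$ is finite it has identity $\sum_{y\in\mathcal{G}_0}1_y\delta_y$ and is a ring extension of $A$ via $a\mapsto\sum_{y\in\mathcal{G}_0}(a1_y)\delta_y$; likewise $A_x\subset A_x\star_{\alpha_{(x)}}\mathcal{G}(x)$ via $a\mapsto a\delta_x$. A unital ring extension $R\subset S$ is separable if there is $e\in S\otimes_R S$ with $se=es$ for all $s\in S$ and $m(e)=1_S$, where $m:S\otimes_R S\to S$ is the multiplication map. *)

theory Defs
  imports "HOL-Algebra.Algebra"
begin

section \<open>Groupoids\<close>

text \<open>Objects are identified with their identity morphisms, so source and target are
  morphisms, and the product of \<open>g\<close> and \<open>h\<close> is meaningful iff \<open>src g = tgt h\<close>.\<close>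

record 'g groupoid_data =
  arr :: "'g set"
  src :: "'g \<Rightarrow> 'g"
  tgt :: "'g \<Rightarrow> 'g"
  gcomp :: "'g \<Rightarrow> 'g \<Rightarrow> 'g"  (infixl "\<bullet>\<index>" 70)

definition objs :: "('g, 'm) groupoid_data_scheme \<Rightarrow> 'g set" where
  "objs G = {y \<in> arr G. src G y = y \<and> tgt G y = y}"

locale groupoid =
  fixes G :: "('g, 'm) groupoid_data_scheme" (structure)
  assumes src_obj: "g \<in> arr G \<Longrightarrow> src G g \<in> objs G"
    and tgt_obj: "g \<in> arr G \<Longrightarrow> tgt G g \<in> objs G"
    and comp_closed: "\<lbrakk>g \<in> arr G; h \<in> arr G; src G g = tgt G h\<rbrakk> \<Longrightarrow> g \<bullet> h \<in> arr G"
    and src_comp: "\<lbrakk>g \<in> arr G; h \<in> arr G; src G g = tgt G h\<rbrakk> \<Longrightarrow> src G (g \<bullet> h) = src G h"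
    and tgt_comp: "\<lbrakk>g \<in> arr G; h \<in> arr G; src G g = tgt G h\<rbrakk> \<Longrightarrow> tgt G (g \<bullet> h) = tgt G g"
    and comp_assoc: "\<lbrakk>g \<in> arr G; h \<in> arr G; k \<in> arr G; src G g = tgt G h; src G h = tgt G k\<rbrakk>
      \<Longrightarrow> (g \<bullet> h) \<bullet> k = g \<bullet> (h \<bullet> k)"
    and comp_src: "g \<in> arr G \<Longrightarrow> g \<bullet> src G g = g"
    and tgt_comp_left: "g \<in> arr G \<Longrightarrow> tgt G g \<bullet> g = g"
    and inverse_exists: "g \<in> arr G \<Longrightarrow>
      \<exists>h\<in>arr G. src G h = tgt G g \<and> tgt G h = src G g \<and> g \<bullet> h = tgt G g \<and> h \<bullet> g = src G g"

definition ginv :: "('g, 'm) groupoid_data_scheme \<Rightarrow> 'g \<Rightarrow> 'g" where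
  "ginv G g = (THE h. h \<in> arr G \<and> src G h = tgt G g \<and> tgt G h = src G g \<and>
     g \<bullet>\<^bsub>G\<^esub> h = tgt G g \<and> h \<bullet>\<^bsub>G\<^esub> g = src G g)"

definition connected_groupoid :: "('g, 'm) groupoid_data_scheme \<Rightarrow> bool" where
  "connected_groupoid G \<longleftrightarrow> groupoid G \<and>
     (\<forall>y\<in>objs G. \<forall>z\<in>objs G. \<exists>g\<in>arr G. src G g = y \<and> tgt G g = z)"

text \<open>The isotropy group, as a groupoid whose only object is \<open>x\<close>.\<close>

definition isotropy :: "('g, 'm) groupoid_data_scheme \<Rightarrow> 'g \<Rightarrow> ('g, 'm) groupoid_data_scheme" where
  "isotropy G x = G\<lparr>arr := {g \<in> arr G. src G g = x \<and> tgt G g = x}\<rparr>"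

definition transversal :: "('g, 'm) groupoid_data_scheme \<Rightarrow> 'g \<Rightarrow> ('g \<Rightarrow> 'g) \<Rightarrow> bool" where
  "transversal G x \<tau> \<longleftrightarrow>
     (\<forall>y\<in>objs G. \<tau> y \<in> arr G \<and> src G (\<tau> y) = x \<and> tgt G (\<tau> y) = y) \<and> \<tau> x = x"


section \<open>Rings without the requirement of an identity\<close>

text \<open>The record of HOL-Algebra rings is used; the field \<open>one\<close> is left unconstrained.\<close>

locale rng = abelian_group R for R (structure) +
  assumes m_closed: "\<lbrakk>a \<in> carrier R; b \<in> carrier R\<rbrakk> \<Longrightarrow> a \<otimes> b \<in> carrier R"
    and m_assoc: "\<lbrakk>a \<in> carrier R; b \<in> carrier R; c \<in> carrier R\<rbrakk> \<Longrightarrow> (a \<otimes> b) \<otimes> c = a \<otimes> (b \<otimes> c)"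
    and l_distr: "\<lbrakk>a \<in> carrier R; b \<in> carrier R; c \<in> carrier R\<rbrakk> \<Longrightarrow> (a \<oplus> b) \<otimes> c = a \<otimes> c \<oplus> b \<otimes> c"
    and r_distr: "\<lbrakk>a \<in> carrier R; b \<in> carrier R; c \<in> carrier R\<rbrakk> \<Longrightarrow> c \<otimes> (a \<oplus> b) = c \<otimes> a \<oplus> c \<otimes> b"

definition rng_ideal :: "'a set \<Rightarrow> ('a, 'm) ring_scheme \<Rightarrow> bool" where
  "rng_ideal I R \<longleftrightarrow> additive_subgroup I R \<and>
     (\<forall>a\<in>I. \<forall>r\<in>carrier R. r \<otimes>\<^bsub>R\<^esub> a \<in> I \<and> a \<otimes>\<^bsub>R\<^esub> r \<in> I)"

definition rng_center :: "('a, 'm) ring_scheme \<Rightarrow> 'a set" where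
  "rng_center R = {c \<in> carrier R. \<forall>r\<in>carrier R. c \<otimes>\<^bsub>R\<^esub> r = r \<otimes>\<^bsub>R\<^esub> c}"

text \<open>Internal direct sum of a finite family of ideals.\<close>

definition is_direct_sum :: "('a, 'm) ring_scheme \<Rightarrow> 'i set \<Rightarrow> ('i \<Rightarrow> 'a set) \<Rightarrow> bool" where
  "is_direct_sum R I B \<longleftrightarrow> finite I \<and> (\<forall>i\<in>I. rng_ideal (B i) R) \<and>
     (\<forall>a\<in>carrier R. \<exists>!f. f \<in> (\<Pi>\<^sub>E i\<in>I. B i) \<and> a = finsum R f I)"


section \<open>Partial actions of groupoids\<close>

text \<open>The family \<open>(A\<^sub>g, \<alpha>\<^sub>g)\<close> is given by \<open>D g = A\<^sub>g\<close> and \<open>\<alpha> g = \<alpha>\<^sub>g\<close>; only the values of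
  \<open>\<alpha> g\<close> on \<open>D (ginv G g)\<close> matter.\<close>

locale partial_action =
  groupoid G + rng A
  for G :: "('g, 'm) groupoid_data_scheme" and A :: "('a, 'n) ring_scheme" +
  fixes D :: "'g \<Rightarrow> 'a set" and \<alpha> :: "'g \<Rightarrow> 'a \<Rightarrow> 'a"
  assumes ideal_tgt: "g \<in> arr G \<Longrightarrow> rng_ideal (D (tgt G g)) A"
    and ideal_dom: "g \<in> arr G \<Longrightarrow> rng_ideal (D g) (A\<lparr>carrier := D (tgt G g)\<rparr>)"
    and iso_bij: "g \<in> arr G \<Longrightarrow> bij_betw (\<alpha> g) (D (ginv G g)) (D g)"
    and iso_add: "\<lbrakk>g \<in> arr G; a \<in> D (ginv G g); b \<in> D (ginv G g)\<rbrakk>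
      \<Longrightarrow> \<alpha> g (a \<oplus>\<^bsub>A\<^esub> b) = \<alpha> g a \<oplus>\<^bsub>A\<^esub> \<alpha> g b"
    and iso_mult: "\<lbrakk>g \<in> arr G; a \<in> D (ginv G g); b \<in> D (ginv G g)\<rbrakk>
      \<Longrightarrow> \<alpha> g (a \<otimes>\<^bsub>A\<^esub> b) = \<alpha> g a \<otimes>\<^bsub>A\<^esub> \<alpha> g b"
    and act_obj: "\<lbrakk>y \<in> objs G; a \<in> D y\<rbrakk> \<Longrightarrow> \<alpha> y a = a"
    and act_comp: "\<lbrakk>g \<in> arr G; h \<in> arr G; src G g = tgt G h; a \<in> D (ginv G h); \<alpha> h a \<in> D (ginv G g)\<rbrakk>
      \<Longrightarrow> a \<in> D (ginv G (g \<bullet>\<^bsub>G\<^esub> h)) \<and> \<alpha> (g \<bullet>\<^bsub>G\<^esub> h) a = \<alpha> g (\<alpha> h a)"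

definition is_unit_idem :: "('a, 'n) ring_scheme \<Rightarrow> ('g \<Rightarrow> 'a set) \<Rightarrow> 'g \<Rightarrow> 'a \<Rightarrow> bool" where
  "is_unit_idem A D g e \<longleftrightarrow> e \<in> rng_center A \<and> e \<otimes>\<^bsub>A\<^esub> e = e \<and> D g = {a \<otimes>\<^bsub>A\<^esub> e |a. a \<in> carrier A}"

definition unital_partial_action ::
  "('g, 'm) groupoid_data_scheme \<Rightarrow> ('a, 'n) ring_scheme \<Rightarrow> ('g \<Rightarrow> 'a set) \<Rightarrow> ('g \<Rightarrow> 'a \<Rightarrow> 'a) \<Rightarrow> bool" where
  "unital_partial_action G A D \<alpha> \<longleftrightarrow>
     partial_action G A D \<alpha> \<and> (\<forall>g\<in>arr G. \<exists>e. is_unit_idem A D g e)"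

text \<open>The idempotent \<open>1\<^sub>g\<close>; it is unique, being the identity element of \<open>D g\<close>.\<close>

definition unit_idem :: "('a, 'n) ring_scheme \<Rightarrow> ('g \<Rightarrow> 'a set) \<Rightarrow> 'g \<Rightarrow> 'a" where
  "unit_idem A D g = (THE e. is_unit_idem A D g e)"

definition group_type :: "('g, 'm) groupoid_data_scheme \<Rightarrow> ('g \<Rightarrow> 'a set) \<Rightarrow> bool" where
  "group_type G D \<longleftrightarrow> (\<exists>x\<in>objs G. \<exists>\<tau>. transversal G x \<tau> \<and>
     (\<forall>y\<in>objs G. D (ginv G (\<tau> y)) = D x \<and> D (\<tau> y) = D y))"

text \<open>The ideal \<open>A\<^sub>x\<close> as a ring; the induced partial action on it has the same families \<open>D\<close> and
  \<open>\<alpha>\<close>, read on the arrows of the isotropy group of \<open>x\<close>.\<close>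

definition ideal_ring :: "('a, 'n) ring_scheme \<Rightarrow> ('g \<Rightarrow> 'a set) \<Rightarrow> 'g \<Rightarrow> ('a, 'n) ring_scheme" where
  "ideal_ring A D x = A\<lparr>carrier := D x, one := unit_idem A D x\<rparr>"


section \<open>Partial skew groupoid rings\<close>

text \<open>A formal sum of the \<open>a\<^sub>g \<delta>\<^sub>g\<close> is the function sending \<open>g\<close> to \<open>a\<^sub>g\<close>, extended by zero outside
  the arrows. The sum defining \<open>one\<close> is a finite formal sum only when there are finitely many
  objects.\<close>

definition skew_ring ::
  "('g, 'm) groupoid_data_scheme \<Rightarrow> ('a, 'n) ring_scheme \<Rightarrow> ('g \<Rightarrow> 'a set) \<Rightarrow> ('g \<Rightarrow> 'a \<Rightarrow> 'a) \<Rightarrow> ('g \<Rightarrow> 'a) ring"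
  where
  "skew_ring G A D \<alpha> =
    \<lparr>carrier = {f. (\<forall>g\<in>arr G. f g \<in> D g) \<and> (\<forall>g. g \<notin> arr G \<longrightarrow> f g = \<zero>\<^bsub>A\<^esub>) \<and>
                   finite {g. f g \<noteq> \<zero>\<^bsub>A\<^esub>}},
     monoid.mult = (\<lambda>f f' k. finsum A
        (\<lambda>(g, h). f g \<otimes>\<^bsub>A\<^esub> \<alpha> g (f' h \<otimes>\<^bsub>A\<^esub> unit_idem A D (ginv G g)))
        {(g, h). g \<in> arr G \<and> h \<in> arr G \<and> f g \<noteq> \<zero>\<^bsub>A\<^esub> \<and> f' h \<noteq> \<zero>\<^bsub>A\<^esub> \<and>
                 src G g = tgt G h \<and> g \<bullet>\<^bsub>G\<^esub> h = k}),
     monoid.one = (\<lambda>g. if g \<in> objs G then unit_idem A D g else \<zero>\<^bsub>A\<^esub>),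
     ring.zero = (\<lambda>g. \<zero>\<^bsub>A\<^esub>),
     ring.add = (\<lambda>f f' g. f g \<oplus>\<^bsub>A\<^esub> f' g)\<rparr>"

text \<open>The map sending \<open>a\<close> to the sum of the \<open>(a 1\<^sub>y) \<delta>\<^sub>y\<close> over the objects \<open>y\<close>. For the isotropy
  group of \<open>x\<close> acting on \<open>A\<^sub>x\<close> it is \<open>a \<mapsto> a \<delta>\<^sub>x\<close>.\<close>

definition skew_embed ::
  "('g, 'm) groupoid_data_scheme \<Rightarrow> ('a, 'n) ring_scheme \<Rightarrow> ('g \<Rightarrow> 'a set) \<Rightarrow> 'a \<Rightarrow> ('g \<Rightarrow> 'a)" where
  "skew_embed G A D a = (\<lambda>g. if g \<in> objs G then a \<otimes>\<^bsub>A\<^esub> unit_idem A D g else \<zero>\<^bsub>A\<^esub>)"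


section \<open>Separable extensions\<close>

text \<open>\<open>S \<otimes>\<^sub>R S\<close> for a subring \<open>R\<close> of \<open>S\<close>: the free abelian group on the pairs of elements of \<open>S\<close>,
  modulo biadditivity and \<open>R\<close>-balancedness.\<close>

definition tensor_rels :: "('s, 'm) ring_scheme \<Rightarrow> 's set \<Rightarrow> ('s \<times> 's \<Rightarrow>\<^sub>0 int) set" where
  "tensor_rels S R =
     {frag_of (a \<oplus>\<^bsub>S\<^esub> b, c) - frag_of (a, c) - frag_of (b, c) |a b c.
        a \<in> carrier S \<and> b \<in> carrier S \<and> c \<in> carrier S} \<union>
     {frag_of (a, b \<oplus>\<^bsub>S\<^esub> c) - frag_of (a, b) - frag_of (a, c) |a b c.
        a \<in> carrier S \<and> b \<in> carrier S \<and> c \<in> carrier S} \<union>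
     {frag_of (a \<otimes>\<^bsub>S\<^esub> r, b) - frag_of (a, r \<otimes>\<^bsub>S\<^esub> b) |a r b.
        a \<in> carrier S \<and> r \<in> R \<and> b \<in> carrier S}"

abbreviation tensor_free :: "('s, 'm) ring_scheme \<Rightarrow> ('s \<times> 's \<Rightarrow>\<^sub>0 int) monoid" where
  "tensor_free S \<equiv> free_Abelian_group (carrier S \<times> carrier S)"

definition tensor_null :: "('s, 'm) ring_scheme \<Rightarrow> 's set \<Rightarrow> ('s \<times> 's \<Rightarrow>\<^sub>0 int) set" where
  "tensor_null S R = generate (tensor_free S) (tensor_rels S R)"

definition tensor :: "('s, 'm) ring_scheme \<Rightarrow> 's set \<Rightarrow> ('s \<times> 's \<Rightarrow>\<^sub>0 int) set monoid" where
  "tensor S R = tensor_free S Mod tensor_null S R"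

text \<open>The two actions of \<open>S\<close> and the multiplication map, induced on cosets from the free group.\<close>

definition tensor_lact :: "('s, 'm) ring_scheme \<Rightarrow> 's set \<Rightarrow> 's \<Rightarrow>
    ('s \<times> 's \<Rightarrow>\<^sub>0 int) set \<Rightarrow> ('s \<times> 's \<Rightarrow>\<^sub>0 int) set" where
  "tensor_lact S R s E = the_elem
     ((\<lambda>c. tensor_null S R #>\<^bsub>tensor_free S\<^esub> frag_extend (\<lambda>(a, b). frag_of (s \<otimes>\<^bsub>S\<^esub> a, b)) c) ` E)"

definition tensor_ract :: "('s, 'm) ring_scheme \<Rightarrow> 's set \<Rightarrow>
    ('s \<times> 's \<Rightarrow>\<^sub>0 int) set \<Rightarrow> 's \<Rightarrow> ('s \<times> 's \<Rightarrow>\<^sub>0 int) set" where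
  "tensor_ract S R E s = the_elem
     ((\<lambda>c. tensor_null S R #>\<^bsub>tensor_free S\<^esub> frag_extend (\<lambda>(a, b). frag_of (a, b \<otimes>\<^bsub>S\<^esub> s)) c) ` E)"

definition tensor_mult :: "('s, 'm) ring_scheme \<Rightarrow> ('s \<times> 's \<Rightarrow>\<^sub>0 int) set \<Rightarrow> 's" where
  "tensor_mult S E = the_elem
     ((\<lambda>c. finsum S (\<lambda>p. [Poly_Mapping.lookup c p] \<cdot>\<^bsub>S\<^esub> (fst p \<otimes>\<^bsub>S\<^esub> snd p)) (Poly_Mapping.keys c)) ` E)"

definition separable_extension :: "'s set \<Rightarrow> ('s, 'm) ring_scheme \<Rightarrow> bool" where
  "separable_extension R S \<longleftrightarrow> ring S \<and> subring R S \<and>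
     (\<exists>e\<in>carrier (tensor S R).
        (\<forall>s\<in>carrier S. tensor_lact S R s e = tensor_ract S R e s) \<and> tensor_mult S e = \<one>\<^bsub>S\<^esub>)"

definition skew_separable ::
  "('g, 'm) groupoid_data_scheme \<Rightarrow> ('a, 'n) ring_scheme \<Rightarrow> ('g \<Rightarrow> 'a set) \<Rightarrow> ('g \<Rightarrow> 'a \<Rightarrow> 'a) \<Rightarrow> bool" where
  "skew_separable G A D \<alpha> \<longleftrightarrow>
     separable_extension (skew_embed G A D ` carrier A) (skew_ring G A D \<alpha>)"

end

(* The trace criterion reduces separability of a partial skew groupoid ring to the existence of
   central elements c y of A_y, one for each object y, such that the sum of alpha_g(c (src g) 1_{g^-1})
   over all g with target y is 1_y. Given such c, the sum of
   alpha_g(c (src g) 1_{g^-1}) delta_g (x) 1_{g^-1} delta_{g^-1} is a separability element. Conversely,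
   the component of a separability element e at delta_y (x) delta_y is a possible c y: comparing the
   components of u e and e u at delta_g (x) delta_{src g} for u = 1_g delta_g identifies the
   contribution of delta_g (x) delta_{g^-1} to m(e) = 1.
   For a group-type action, central elements with trace 1 transfer between the isotropy group at x and
   the whole groupoid along the isomorphisms alpha_{tau_y}: extend an element of A_x by zero, and
   conversely sum the alpha_{tau_z^-1}(c z). *)

theory Submission
  imports Defs
begin

section \<open>Finite sums in rings without identity\<close>

text \<open>The obstacle is partiality: \<alpha>_g \<alpha>_h and \<alpha>_{gh} agree only on part
  of their domains, so computations would carry domain conditions everywhere. Extending each
  \<alpha>_g by zero to a map \<open>act g\<close> on all of A turns the composition law into an
  identity without domain conditions, act g (act h a) = 1_g act (gh) a. The error factor 1_g is
  harmless whenever it meets an element of A_g. In the passage between the groupoid and the isotropy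
  group this is where group type enters: 1_{\<tau>_y} = 1_y acts as an identity on every A_g with
  target y.

  The tensor product is a quotient of a free abelian group, so a separability element is handled
  through a representative. That a difference lies in the relation subgroup is shown by summing
  elementary relations. Conversely, information is extracted by applying the balanced maps (s, t)
  |-> s_g act g (t_h) with s(g) = t(h), which vanish on that subgroup. The twist by
  \<open>act g\<close> makes them compatible with moving a scalar across the tensor sign, and makes
  their sums over factorizations of k equal to the coefficient of st at k.\<close>

lemma (in abelian_monoid) finsum_delta:
  assumes I: "finite I" "i \<in> I" and F: "F i \<in> carrier G" and zero: "\<And>j. \<lbrakk>j \<in> I; j \<noteq> i\<rbrakk> \<Longrightarrow> F j = \<zero>"
  shows "finsum G F I = F i"
proof -
  have "F j \<in> carrier G" if "j \<in> I" for j
    using F zero[OF that] by (cases "j = i") auto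
  then have "finsum G F {i} = finsum G F I"
    using assms by (intro add.finprod_mono_neutral_cong_left) auto
  then show ?thesis using F by simp
qed

lemma (in abelian_monoid) finsum_Times:
  assumes I: "finite I" and J: "finite J" and f: "\<And>i j. \<lbrakk>i \<in> I; j \<in> J\<rbrakk> \<Longrightarrow> f i j \<in> carrier G"
  shows "finsum G (\<lambda>(i, j). f i j) (I \<times> J) = finsum G (\<lambda>i. finsum G (f i) J) I"
proof -
  have "finsum G (\<lambda>(i, j). f i j) (\<Union>i\<in>I. Pair i ` J)
      = finsum G (\<lambda>i. finsum G (\<lambda>(i, j). f i j) (Pair i ` J)) I"
    using assms by (intro add.finprod_UN_disjoint) (auto simp: pairwise_def disjnt_def)
  also have "\<dots> = finsum G (\<lambda>i. finsum G (f i) J) I"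
  proof (rule finsum_cong')
    fix i assume i: "i \<in> I"
    show "finsum G (\<lambda>(i, j). f i j) (Pair i ` J) = finsum G (f i) J"
      using f i by (subst finsum_reindex) (auto simp: inj_on_def)
  qed (use f in \<open>auto intro!: finsum_closed\<close>)
  also have "(\<Union>i\<in>I. Pair i ` J) = I \<times> J" by auto
  finally show ?thesis .
qed

context rng
begin

lemma l_null [simp]: "a \<in> carrier R \<Longrightarrow> \<zero> \<otimes> a = \<zero>"
  using l_distr[of \<zero> \<zero> a] m_closed[of \<zero> a]
  by (metis add.l_cancel_one' zero_closed l_zero)

lemma r_null [simp]: "a \<in> carrier R \<Longrightarrow> a \<otimes> \<zero> = \<zero>"
  using r_distr[of \<zero> \<zero> a] m_closed[of a \<zero>]
  by (metis add.l_cancel_one' zero_closed l_zero)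

lemma finsum_ldistr:
  "\<lbrakk>finite I; a \<in> carrier R; f \<in> I \<rightarrow> carrier R\<rbrakk>
    \<Longrightarrow> finsum R f I \<otimes> a = finsum R (\<lambda>i. f i \<otimes> a) I"
  by (induction I rule: finite_induct) (auto simp: l_distr m_closed Pi_iff)

lemma finsum_rdistr:
  "\<lbrakk>finite I; a \<in> carrier R; f \<in> I \<rightarrow> carrier R\<rbrakk>
    \<Longrightarrow> a \<otimes> finsum R f I = finsum R (\<lambda>i. a \<otimes> f i) I"
  by (induction I rule: finite_induct) (auto simp: r_distr m_closed Pi_iff)

end

section \<open>Sums over the free abelian group and tensor products\<close>

text \<open>The additive extension of \<open>\<phi>\<close> from generators to the free abelian
  group. For \<open>\<phi>\<close> the product of a pair it is the sum inside
  \<open>tensor_mult\<close>, so the multiplication map and the evaluation of balanced maps share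
  one set of rules.\<close>

definition frag_sum :: "('a, 'm) ring_scheme \<Rightarrow> ('p \<Rightarrow> 'a) \<Rightarrow> ('p \<Rightarrow>\<^sub>0 int) \<Rightarrow> 'a" where
  "frag_sum R \<phi> c = finsum R (\<lambda>p. [Poly_Mapping.lookup c p] \<cdot>\<^bsub>R\<^esub> \<phi> p) (Poly_Mapping.keys c)"

context abelian_group
begin

text \<open>Zero coefficients contribute zero. A common finite index set is needed because
  cancellation can make the support of \<open>c + d\<close> smaller than the union of the two
  supports.\<close>

lemma frag_sum_superset:
  assumes "finite K" "Poly_Mapping.keys c \<subseteq> K" "\<phi> \<in> K \<rightarrow> carrier G"
  shows "frag_sum G \<phi> c = finsum G (\<lambda>p. [Poly_Mapping.lookup c p] \<cdot>\<^bsub>G\<^esub> \<phi> p) K"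
  unfolding frag_sum_def
proof (rule add.finprod_mono_neutral_cong_left)
  show "[Poly_Mapping.lookup c p] \<cdot>\<^bsub>G\<^esub> \<phi> p = \<zero>" if "p \<in> K - Poly_Mapping.keys c" for p
    using that by (simp add: in_keys_iff add_pow_def)
qed (use assms in auto)

lemma frag_sum_closed:
  assumes "Poly_Mapping.keys c \<subseteq> B" "\<phi> \<in> B \<rightarrow> carrier G"
  shows "frag_sum G \<phi> c \<in> carrier G"
  unfolding frag_sum_def using assms by (intro finsum_closed) (auto simp: Pi_iff subset_iff)

lemma frag_sum_zero [simp]: "frag_sum G \<phi> 0 = \<zero>"
  by (simp add: frag_sum_def)

lemma frag_sum_of [simp]: "\<phi> p \<in> carrier G \<Longrightarrow> frag_sum G \<phi> (frag_of p) = \<phi> p"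
  by (simp add: frag_sum_def keys_frag_of)

lemma frag_sum_add:
  assumes "Poly_Mapping.keys c \<subseteq> B" "Poly_Mapping.keys d \<subseteq> B" "\<phi> \<in> B \<rightarrow> carrier G"
  shows "frag_sum G \<phi> (c + d) = frag_sum G \<phi> c \<oplus> frag_sum G \<phi> d"
proof -
  let ?K = "Poly_Mapping.keys c \<union> Poly_Mapping.keys d"
  have \<phi>: "\<phi> \<in> ?K \<rightarrow> carrier G" using assms by auto
  have "frag_sum G \<phi> (c + d) = finsum G (\<lambda>p. [Poly_Mapping.lookup (c + d) p] \<cdot>\<^bsub>G\<^esub> \<phi> p) ?K"
    by (rule frag_sum_superset[OF _ _ \<phi>]) (auto simp: Poly_Mapping.keys_add)
  also have "\<dots> = finsum G (\<lambda>p. [Poly_Mapping.lookup c p] \<cdot>\<^bsub>G\<^esub> \<phi> p \<oplus> [Poly_Mapping.lookup d p] \<cdot>\<^bsub>G\<^esub> \<phi> p) ?K"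
    by (rule finsum_cong') (use \<phi> in \<open>auto simp: lookup_add add.int_pow_mult Pi_iff\<close>)
  also have "\<dots> = frag_sum G \<phi> c \<oplus> frag_sum G \<phi> d"
    using \<phi> by (subst finsum_addf) (auto simp: frag_sum_superset[OF _ _ \<phi>] Pi_iff)
  finally show ?thesis .
qed

lemma frag_sum_hom:
  assumes "\<phi> \<in> B \<rightarrow> carrier G"
  shows "frag_sum G \<phi> \<in> hom (free_Abelian_group B) (add_monoid G)"
  using assms frag_sum_closed frag_sum_add by (auto simp: hom_def)

end

section \<open>Homomorphisms out of a free abelian group\<close>

lemma keys_add_subset:
  "\<lbrakk>Poly_Mapping.keys c \<subseteq> B; Poly_Mapping.keys d \<subseteq> B\<rbrakk> \<Longrightarrow> Poly_Mapping.keys (c + d) \<subseteq> B"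
  using Poly_Mapping.keys_add[of c d] by blast

lemma keys_diff_subset:
  "\<lbrakk>Poly_Mapping.keys c \<subseteq> B; Poly_Mapping.keys d \<subseteq> B\<rbrakk> \<Longrightarrow> Poly_Mapping.keys (c - d) \<subseteq> B"
  using keys_diff[of c d] by blast

text \<open>The uniqueness half of the universal property: differences of generators reach every
  element. The naturality rules for \<open>frag_sum\<close> then need only a check on
  generators.\<close>

lemma (in group) hom_free_Abelian_group_eq:
  assumes h: "h \<in> hom (free_Abelian_group B) G" and k: "k \<in> hom (free_Abelian_group B) G"
    and eq: "\<And>p. p \<in> B \<Longrightarrow> h (frag_of p) = k (frag_of p)"
    and c: "Poly_Mapping.keys c \<subseteq> B"
  shows "h c = k c"
proof -
  interpret h: group_hom "free_Abelian_group B" G h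
    using h by (simp add: group_hom_def group_hom_axioms_def is_group)
  interpret k: group_hom "free_Abelian_group B" G k
    using k by (simp add: group_hom_def group_hom_axioms_def is_group)
  \<comment> \<open>The support condition is part of the induction claim because \<open>h\<close>
    and \<open>k\<close> are additive only on the carrier.\<close>
  have "Poly_Mapping.keys c \<subseteq> B \<and> h c = k c"
    using c
  proof (induction c rule: frag_induction)
    case zero
    show ?case using h.hom_one k.hom_one by simp
  next
    case (one p)
    then show ?case using eq by simp
  next
    case (diff c d)
    then have "h (c + - d) = h c \<otimes> inv (h d)" "k (c + - d) = k c \<otimes> inv (k d)"
      using h.hom_mult[of c "- d"] k.hom_mult[of c "- d"] h.hom_inv[of d] k.hom_inv[of d]
      by simp_all
    with diff show ?case by (simp add: keys_diff_subset)
  qed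
  then show ?thesis by simp
qed

lemma keys_frag_map_subset:
  assumes "f \<in> B \<rightarrow> Y" "Poly_Mapping.keys c \<subseteq> B"
  shows "Poly_Mapping.keys (frag_extend (\<lambda>p. frag_of (f p)) c) \<subseteq> Y"
  using keys_frag_extend[of "\<lambda>p. frag_of (f p)" c] assms by (force simp: keys_frag_of)

lemma frag_map_hom:
  "f \<in> B \<rightarrow> Y \<Longrightarrow> frag_extend (\<lambda>p. frag_of (f p)) \<in> hom (free_Abelian_group B) (free_Abelian_group Y)"
  using keys_frag_map_subset[of f B Y] by (auto simp: hom_def frag_extend_add)

lemma (in abelian_group) frag_sum_frag_map:
  assumes f: "f \<in> B \<rightarrow> Y" and \<phi>: "\<phi> \<in> Y \<rightarrow> carrier G" and c: "Poly_Mapping.keys c \<subseteq> B"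
  shows "frag_sum G \<phi> (frag_extend (\<lambda>p. frag_of (f p)) c) = frag_sum G (\<lambda>p. \<phi> (f p)) c"
  using add.hom_free_Abelian_group_eq[OF
      hom_compose[OF frag_map_hom[OF f] frag_sum_hom[OF \<phi>]] frag_sum_hom[of "\<lambda>p. \<phi> (f p)" B] _ c]
    f \<phi> by (auto simp: Pi_iff)

text \<open>Both sides are homomorphisms that agree on generators. The rule pushes multiplication by
  a ring element, \<open>act g\<close>, and the coefficient at an arrow through an
  evaluation.\<close>

lemma (in abelian_group) hom_frag_sum:
  assumes \<phi>: "\<phi> \<in> B \<rightarrow> carrier G" and h: "h \<in> hom (add_monoid G) (add_monoid H)"
    and H: "abelian_group H" and c: "Poly_Mapping.keys c \<subseteq> B"
  shows "h (frag_sum G \<phi> c) = frag_sum H (\<lambda>p. h (\<phi> p)) c"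
proof -
  interpret H: abelian_group H by (rule H)
  have h\<phi>: "(\<lambda>p. h (\<phi> p)) \<in> B \<rightarrow> carrier H" using \<phi> h by (auto simp: hom_def)
  show ?thesis
    using H.add.hom_free_Abelian_group_eq[OF
      hom_compose[OF frag_sum_hom[OF \<phi>] h] H.frag_sum_hom[OF h\<phi>] _ c]
    \<phi> h\<phi> by (auto simp: Pi_iff)
qed

lemma (in abelian_group) frag_sum_cong:
  assumes "\<And>p. p \<in> B \<Longrightarrow> \<phi> p = \<psi> p" "\<psi> \<in> B \<rightarrow> carrier G" "Poly_Mapping.keys c \<subseteq> B"
  shows "frag_sum G \<phi> c = frag_sum G \<psi> c"
  unfolding frag_sum_def
  by (rule finsum_cong') (use assms in \<open>auto simp: Pi_iff subset_iff\<close>)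

lemma (in abelian_group) frag_sum_addf:
  assumes "\<phi> \<in> B \<rightarrow> carrier G" "\<psi> \<in> B \<rightarrow> carrier G" "Poly_Mapping.keys c \<subseteq> B"
  shows "frag_sum G (\<lambda>p. \<phi> p \<oplus> \<psi> p) c = frag_sum G \<phi> c \<oplus> frag_sum G \<psi> c"
proof -
  have *: "\<phi> p \<in> carrier G" "\<psi> p \<in> carrier G" if "p \<in> Poly_Mapping.keys c" for p
    using assms that by auto
  have "frag_sum G (\<lambda>p. \<phi> p \<oplus> \<psi> p) c
      = finsum G (\<lambda>p. [Poly_Mapping.lookup c p] \<cdot>\<^bsub>G\<^esub> \<phi> p \<oplus> [Poly_Mapping.lookup c p] \<cdot>\<^bsub>G\<^esub> \<psi> p)
          (Poly_Mapping.keys c)"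
    unfolding frag_sum_def by (rule finsum_cong') (simp_all add: * Pi_iff add.int_pow_distrib)
  also have "\<dots> = frag_sum G \<phi> c \<oplus> frag_sum G \<psi> c"
    unfolding frag_sum_def by (rule finsum_addf) (simp_all add: * Pi_iff)
  finally show ?thesis .
qed

lemma (in abelian_group) frag_sum_finsum:
  assumes "finite I" "\<And>i. i \<in> I \<Longrightarrow> \<phi> i \<in> B \<rightarrow> carrier G" and c: "Poly_Mapping.keys c \<subseteq> B"
  shows "finsum G (\<lambda>i. frag_sum G (\<phi> i) c) I = frag_sum G (\<lambda>p. finsum G (\<lambda>i. \<phi> i p) I) c"
  using assms(1,2)
proof (induction I)
  case empty
  show ?case using c by (auto simp: frag_sum_def)
next
  case (insert j I)
  have fs: "(\<lambda>p. \<phi> j p) \<in> B \<rightarrow> carrier G" "(\<lambda>p. finsum G (\<lambda>i. \<phi> i p) I) \<in> B \<rightarrow> carrier G"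
    using insert.prems by (auto simp: Pi_iff intro!: finsum_closed)
  have "frag_sum G (\<lambda>p. finsum G (\<lambda>i. \<phi> i p) (insert j I)) c
      = frag_sum G (\<lambda>p. \<phi> j p \<oplus> finsum G (\<lambda>i. \<phi> i p) I) c"
    by (rule frag_sum_cong[OF _ _ c]) (use insert fs in \<open>auto simp: Pi_iff\<close>)
  also have "\<dots> = frag_sum G (\<phi> j) c \<oplus> frag_sum G (\<lambda>p. finsum G (\<lambda>i. \<phi> i p) I) c"
    by (rule frag_sum_addf[OF fs c])
  also have "\<dots> = finsum G (\<lambda>i. frag_sum G (\<phi> i) c) (insert j I)"
    using insert fs(1) c by (simp add: frag_sum_closed Pi_iff)
  finally show ?case by simp
qed

lemma (in abelian_group) frag_sum_sum:
  assumes "finite I" "\<And>i. i \<in> I \<Longrightarrow> Poly_Mapping.keys (c i) \<subseteq> B" "\<phi> \<in> B \<rightarrow> carrier G"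
  shows "frag_sum G \<phi> (sum c I) = finsum G (\<lambda>i. frag_sum G \<phi> (c i)) I"
  using assms(1,2)
proof (induction I rule: finite_induct)
  case (insert i I)
  have "Poly_Mapping.keys (sum c I) \<subseteq> B"
    using sum_closed_free_Abelian_group[of I c B] insert.prems by simp
  then have "frag_sum G \<phi> (sum c (insert i I)) = frag_sum G \<phi> (c i) \<oplus> frag_sum G \<phi> (sum c I)"
    using insert frag_sum_add[OF _ _ assms(3), of "c i" "sum c I"] by simp
  moreover have "frag_sum G \<phi> (c j) \<in> carrier G" if "j \<in> insert i I" for j
    using frag_sum_closed[OF _ assms(3)] insert.prems that by blast
  ultimately show ?case using insert by (simp add: Pi_iff)
qed simp

section \<open>Tensor products by generators and relations\<close>

locale ring_pair = ring S for S (structure) +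
  fixes R
  assumes sub: "R \<subseteq> carrier S"
begin

abbreviation "pairs \<equiv> carrier S \<times> carrier S"

text \<open>These are the maps on pairs that induce additive maps from the tensor product to an
  abelian group \<open>H\<close>.\<close>

definition balanced where
  "balanced H \<phi> \<longleftrightarrow> \<phi> \<in> pairs \<rightarrow> carrier H \<and>
     (\<forall>a\<in>carrier S. \<forall>b\<in>carrier S. \<forall>c\<in>carrier S.
        \<phi> (a \<oplus> b, c) = \<phi> (a, c) \<oplus>\<^bsub>H\<^esub> \<phi> (b, c) \<and> \<phi> (a, b \<oplus> c) = \<phi> (a, b) \<oplus>\<^bsub>H\<^esub> \<phi> (a, c)) \<and>
     (\<forall>a\<in>carrier S. \<forall>r\<in>R. \<forall>b\<in>carrier S. \<phi> (a \<otimes> r, b) = \<phi> (a, r \<otimes> b))"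

lemma tensor_rels_subset: "tensor_rels S R \<subseteq> carrier (tensor_free S)"
proof -
  have "r \<in> carrier S" if "r \<in> R" for r
    using that sub by blast
  then show ?thesis
    unfolding tensor_rels_def
    by (intro subsetI, elim UnE CollectE exE conjE) (simp_all add: keys_diff_subset keys_frag_of)
qed

lemma tensor_null_subgroup: "subgroup (tensor_null S R) (tensor_free S)"
  unfolding tensor_null_def
  by (rule group.generate_is_subgroup[OF group_free_Abelian_group tensor_rels_subset])

lemma tensor_null_keys: "c \<in> tensor_null S R \<Longrightarrow> Poly_Mapping.keys c \<subseteq> pairs"
  using subsetD[OF subgroup.subset[OF tensor_null_subgroup], of c] by simp

lemma tensor_null_zero: "0 \<in> tensor_null S R"
  using subgroup.one_closed[OF tensor_null_subgroup] by simp

lemma tensor_null_add: "\<lbrakk>c \<in> tensor_null S R; d \<in> tensor_null S R\<rbrakk> \<Longrightarrow> c + d \<in> tensor_null S R"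
  using subgroup.m_closed[OF tensor_null_subgroup] by simp

lemma tensor_null_minus: "c \<in> tensor_null S R \<Longrightarrow> - c \<in> tensor_null S R"
  using subgroup.m_inv_closed[OF tensor_null_subgroup, of c] tensor_null_keys[of c] by simp

lemma tensor_null_diff: "\<lbrakk>c \<in> tensor_null S R; d \<in> tensor_null S R\<rbrakk> \<Longrightarrow> c - d \<in> tensor_null S R"
  using tensor_null_add[of c "- d"] tensor_null_minus by simp

lemma tensor_null_rel: "c \<in> tensor_rels S R \<Longrightarrow> c \<in> tensor_null S R"
  unfolding tensor_null_def by (rule generate.incl)

text \<open>The generated subgroup goes where its generators go. With \<open>T\<close> the relation
  subgroup this makes the two actions of S well defined; with \<open>T\<close> trivial it makes
  balanced maps vanish on relations.\<close>

lemma tensor_null_hom: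
  assumes H: "group H" and h: "h \<in> hom (tensor_free S) H" and T: "subgroup T H"
    and rels: "\<And>c. c \<in> tensor_rels S R \<Longrightarrow> h c \<in> T" and c: "c \<in> tensor_null S R"
  shows "h c \<in> T"
proof -
  interpret h: group_hom "tensor_free S" H h
    using H h by (simp add: group_hom_def group_hom_axioms_def)
  have rels_carrier: "d \<in> carrier (tensor_free S)" if "d \<in> tensor_rels S R" for d
    using that tensor_rels_subset by blast
  show ?thesis
    using c unfolding tensor_null_def
  proof induction
    case one
    show ?case using subgroup.one_closed[OF T] h.hom_one by simp
  next
    case (incl d)
    then show ?case by (rule rels)
  next
    case (inv d)
    then show ?case
      using h.hom_inv[OF rels_carrier] subgroup.m_inv_closed[OF T] rels by metis
  next
    case (eng c d)
    then have "c \<in> carrier (tensor_free S)" "d \<in> carrier (tensor_free S)"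
      using tensor_null_keys unfolding tensor_null_def by auto
    then show ?case
      using h.hom_mult subgroup.m_closed[OF T] eng by metis
  qed
qed

lemma tensor_coset_eq_iff:
  assumes "Poly_Mapping.keys c \<subseteq> pairs" "Poly_Mapping.keys d \<subseteq> pairs"
  shows "tensor_null S R #>\<^bsub>tensor_free S\<^esub> c = tensor_null S R #>\<^bsub>tensor_free S\<^esub> d
    \<longleftrightarrow> c - d \<in> tensor_null S R"
proof
  assume "tensor_null S R #>\<^bsub>tensor_free S\<^esub> c = tensor_null S R #>\<^bsub>tensor_free S\<^esub> d"
  moreover have "c \<in> tensor_null S R #>\<^bsub>tensor_free S\<^esub> c"
    using tensor_null_zero by (force simp: r_coset_def)
  ultimately show "c - d \<in> tensor_null S R"
    by (auto simp: r_coset_def)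
next
  assume cd: "c - d \<in> tensor_null S R"
  have "n + c \<in> tensor_null S R #>\<^bsub>tensor_free S\<^esub> d" if "n \<in> tensor_null S R" for n
    using tensor_null_add[OF that cd] by (force simp: r_coset_def algebra_simps)
  moreover have "n + d \<in> tensor_null S R #>\<^bsub>tensor_free S\<^esub> c" if "n \<in> tensor_null S R" for n
    using tensor_null_diff[OF that cd] by (force simp: r_coset_def algebra_simps)
  ultimately show "tensor_null S R #>\<^bsub>tensor_free S\<^esub> c = tensor_null S R #>\<^bsub>tensor_free S\<^esub> d"
    by (auto simp: r_coset_def)
qed

lemma carrier_tensor:
  "carrier (tensor S R) = {tensor_null S R #>\<^bsub>tensor_free S\<^esub> c |c. Poly_Mapping.keys c \<subseteq> pairs}"
  by (auto simp: tensor_def FactGroup_def RCOSETS_def)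

text \<open>The actions and the multiplication map are defined through \<open>the_elem\<close> of
  the image of a coset; invariance under the relations makes that image a singleton.\<close>

lemma the_elem_coset_image:
  assumes "\<And>n. n \<in> tensor_null S R \<Longrightarrow> f (n + c) = f c"
  shows "the_elem (f ` (tensor_null S R #>\<^bsub>tensor_free S\<^esub> c)) = f c"
proof -
  have "f ` (tensor_null S R #>\<^bsub>tensor_free S\<^esub> c) = {f c}"
    using assms tensor_null_zero by (force simp: r_coset_def)
  then show ?thesis by simp
qed

abbreviation lmult_frag where
  "lmult_frag s \<equiv> frag_extend (\<lambda>(a, b). frag_of (s \<otimes> a, b))"

abbreviation rmult_frag where
  "rmult_frag s \<equiv> frag_extend (\<lambda>(a, b). frag_of (a, b \<otimes> s))"

lemma lmult_frag_alt: "lmult_frag s = frag_extend (\<lambda>p. frag_of (s \<otimes> fst p, snd p))"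
  by (simp add: case_prod_beta')

lemma rmult_frag_alt: "rmult_frag s = frag_extend (\<lambda>p. frag_of (fst p, snd p \<otimes> s))"
  by (simp add: case_prod_beta')

lemma keys_lmult_frag: "\<lbrakk>s \<in> carrier S; Poly_Mapping.keys c \<subseteq> pairs\<rbrakk> \<Longrightarrow> Poly_Mapping.keys (lmult_frag s c) \<subseteq> pairs"
  unfolding lmult_frag_alt by (rule keys_frag_map_subset) auto

lemma keys_rmult_frag: "\<lbrakk>s \<in> carrier S; Poly_Mapping.keys c \<subseteq> pairs\<rbrakk> \<Longrightarrow> Poly_Mapping.keys (rmult_frag s c) \<subseteq> pairs"
  unfolding rmult_frag_alt by (rule keys_frag_map_subset) auto

text \<open>Distributivity and associativity turn each of the three kinds of relation into a
  relation of the same kind. \<open>rmult_frag_null\<close> is the mirror image in the second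
  factor.\<close>

lemma lmult_frag_null:
  assumes s: "s \<in> carrier S" and c: "c \<in> tensor_null S R"
  shows "lmult_frag s c \<in> tensor_null S R"
proof (rule tensor_null_hom[OF group_free_Abelian_group _ tensor_null_subgroup _ c])
  show "lmult_frag s \<in> hom (tensor_free S) (tensor_free S)"
    unfolding lmult_frag_alt by (rule frag_map_hom) (use s in auto)
  fix d assume "d \<in> tensor_rels S R"
  then have "lmult_frag s d \<in> tensor_rels S R"
    unfolding tensor_rels_def
    apply (elim UnE CollectE exE conjE)
    subgoal for a b c
      using s by (intro UnI1 CollectI exI[of _ "s \<otimes> a"] exI[of _ "s \<otimes> b"] exI[of _ c])
        (auto simp: frag_extend_diff r_distr)
    subgoal for a b c
      using s by (intro UnI1 UnI2 CollectI exI[of _ "s \<otimes> a"] exI[of _ b] exI[of _ c])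
        (auto simp: frag_extend_diff)
    subgoal for a r b
      using s sub by (intro UnI2 CollectI exI[of _ "s \<otimes> a"] exI[of _ r] exI[of _ b])
        (auto simp: frag_extend_diff m_assoc)
    done
  then show "lmult_frag s d \<in> tensor_null S R" by (rule tensor_null_rel)
qed

lemma rmult_frag_null:
  assumes s: "s \<in> carrier S" and c: "c \<in> tensor_null S R"
  shows "rmult_frag s c \<in> tensor_null S R"
proof (rule tensor_null_hom[OF group_free_Abelian_group _ tensor_null_subgroup _ c])
  show "rmult_frag s \<in> hom (tensor_free S) (tensor_free S)"
    unfolding rmult_frag_alt by (rule frag_map_hom) (use s in auto)
  fix d assume "d \<in> tensor_rels S R"
  then have "rmult_frag s d \<in> tensor_rels S R"
    unfolding tensor_rels_def
    apply (elim UnE CollectE exE conjE)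
    subgoal for a b c
      using s by (intro UnI1 CollectI exI[of _ a] exI[of _ b] exI[of _ "c \<otimes> s"])
        (auto simp: frag_extend_diff)
    subgoal for a b c
      using s by (intro UnI1 UnI2 CollectI exI[of _ a] exI[of _ "b \<otimes> s"] exI[of _ "c \<otimes> s"])
        (auto simp: frag_extend_diff l_distr)
    subgoal for a r b
      using s sub by (intro UnI2 CollectI exI[of _ a] exI[of _ r] exI[of _ "b \<otimes> s"])
        (auto simp: frag_extend_diff m_assoc)
    done
  then show "rmult_frag s d \<in> tensor_null S R" by (rule tensor_null_rel)
qed

text \<open>On each kind of relation the value cancels by one clause of \<open>balanced\<close>.
  This serves both the well-definedness of the multiplication map and the reading of components of a
  tensor.\<close>

lemma frag_sum_null:
  assumes H: "abelian_group H" and \<phi>: "balanced H \<phi>" and c: "c \<in> tensor_null S R"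
  shows "frag_sum H \<phi> c = \<zero>\<^bsub>H\<^esub>"
proof -
  interpret H: abelian_group H by (rule H)
  have \<phi>_closed: "\<phi> \<in> pairs \<rightarrow> carrier H" using \<phi> by (simp add: balanced_def)
  interpret h: group_hom "tensor_free S" "add_monoid H" "frag_sum H \<phi>"
    using H.frag_sum_hom[OF \<phi>_closed] by (simp add: group_hom_def group_hom_axioms_def H.a_group)
  have diff: "frag_sum H \<phi> (p - q) = frag_sum H \<phi> p \<ominus>\<^bsub>H\<^esub> frag_sum H \<phi> q"
    if "Poly_Mapping.keys p \<subseteq> pairs" "Poly_Mapping.keys q \<subseteq> pairs" for p q
    using h.hom_mult[of p "- q"] h.hom_inv[of q] that by (simp add: a_minus_def a_inv_def)
  have "frag_sum H \<phi> c \<in> {\<zero>\<^bsub>H\<^esub>}"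
  proof (rule tensor_null_hom[OF H.a_group h.homh _ _ c])
    show "subgroup {\<zero>\<^bsub>H\<^esub>} (add_monoid H)"
      using H.add.triv_subgroup by simp
    fix d assume d: "d \<in> tensor_rels S R"
    have *: "\<phi> (a, b) \<in> carrier H" if "a \<in> carrier S" "b \<in> carrier S" for a b
      using \<phi>_closed that by auto
    have sum0: "(u \<oplus>\<^bsub>H\<^esub> v) \<ominus>\<^bsub>H\<^esub> u \<ominus>\<^bsub>H\<^esub> v = \<zero>\<^bsub>H\<^esub>"
      if "u \<in> carrier H" "v \<in> carrier H" for u v
    proof -
      have "(u \<oplus>\<^bsub>H\<^esub> v) \<ominus>\<^bsub>H\<^esub> u = v"
        using that by (metis H.a_assoc H.a_comm H.a_inv_closed H.minus_eq H.r_neg1)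
      with that show ?thesis by (simp add: H.minus_eq H.r_neg)
    qed
    have fr: "frag_sum H \<phi> (frag_of (a, b)) = \<phi> (a, b)" if "a \<in> carrier S" "b \<in> carrier S" for a b
      using * that by simp
    have kf: "Poly_Mapping.keys (frag_of (a, b)) \<subseteq> pairs" if "a \<in> carrier S" "b \<in> carrier S" for a b
      using that by (simp add: keys_frag_of)
    consider (left) a b e where "d = frag_of (a \<oplus> b, e) - frag_of (a, e) - frag_of (b, e)"
        "a \<in> carrier S" "b \<in> carrier S" "e \<in> carrier S"
      | (right) a b e where "d = frag_of (a, b \<oplus> e) - frag_of (a, b) - frag_of (a, e)"
        "a \<in> carrier S" "b \<in> carrier S" "e \<in> carrier S"
      | (mid) a r b where "d = frag_of (a \<otimes> r, b) - frag_of (a, r \<otimes> b)"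
        "a \<in> carrier S" "r \<in> R" "b \<in> carrier S"
      using d unfolding tensor_rels_def by auto
    then show "frag_sum H \<phi> d \<in> {\<zero>\<^bsub>H\<^esub>}"
    proof cases
      case left
      then show ?thesis
        using \<phi> by (simp add: diff keys_diff_subset kf fr balanced_def sum0 *)
    next
      case right
      then show ?thesis
        using \<phi> by (simp add: diff keys_diff_subset kf fr balanced_def sum0 *)
    next
      case mid
      then have "r \<in> carrier S" using sub by auto
      moreover have "\<phi> (a \<otimes> r, b) = \<phi> (a, r \<otimes> b)" using \<phi> mid unfolding balanced_def by blast
      ultimately show ?thesis
        using mid by (simp add: diff keys_diff_subset kf fr H.minus_eq H.r_neg *)
    qed
  qed
  then show ?thesis by simp
qed

text \<open>Every coset has a representative \<open>c\<close>, both actions lift to the free group,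
  and equality of cosets is a difference in \<open>tensor_null\<close>. After this equivalence all
  arguments stay in the free group.\<close>

lemma separable_extension_iff:
  assumes "subring R S"
  shows "separable_extension R S \<longleftrightarrow>
    (\<exists>c. Poly_Mapping.keys c \<subseteq> pairs \<and> (\<forall>s\<in>carrier S. lmult_frag s c - rmult_frag s c \<in> tensor_null S R) \<and>
       frag_sum S (\<lambda>p. fst p \<otimes> snd p) c = \<one>)"
proof -
  have mult: "tensor_mult S (tensor_null S R #>\<^bsub>tensor_free S\<^esub> c) = frag_sum S (\<lambda>p. fst p \<otimes> snd p) c"
    if "Poly_Mapping.keys c \<subseteq> pairs" for c
    unfolding tensor_mult_def frag_sum_def[symmetric]
  proof (rule the_elem_coset_image)
    fix n assume n: "n \<in> tensor_null S R"
    have bal: "balanced S (\<lambda>p. fst p \<otimes> snd p)"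
      using sub by (auto simp: balanced_def l_distr r_distr m_assoc)
    show "frag_sum S (\<lambda>p. fst p \<otimes> snd p) (n + c) = frag_sum S (\<lambda>p. fst p \<otimes> snd p) c"
      using that by (subst frag_sum_add[OF tensor_null_keys[OF n]])
        (auto simp: frag_sum_null[OF abelian_group_axioms bal n] intro!: l_zero frag_sum_closed)
  qed
  have lact: "tensor_lact S R s (tensor_null S R #>\<^bsub>tensor_free S\<^esub> c)
      = tensor_null S R #>\<^bsub>tensor_free S\<^esub> lmult_frag s c"
    if "s \<in> carrier S" "Poly_Mapping.keys c \<subseteq> pairs" for s c
    unfolding tensor_lact_def
    by (rule the_elem_coset_image, subst tensor_coset_eq_iff)
      (use that in \<open>simp_all add: keys_add_subset keys_lmult_frag frag_extend_add lmult_frag_null tensor_null_keys\<close>)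
  have ract: "tensor_ract S R (tensor_null S R #>\<^bsub>tensor_free S\<^esub> c) s
      = tensor_null S R #>\<^bsub>tensor_free S\<^esub> rmult_frag s c"
    if "s \<in> carrier S" "Poly_Mapping.keys c \<subseteq> pairs" for s c
    unfolding tensor_ract_def
    by (rule the_elem_coset_image, subst tensor_coset_eq_iff)
      (use that in \<open>simp_all add: keys_add_subset keys_rmult_frag frag_extend_add rmult_frag_null tensor_null_keys\<close>)
  have *: "(\<forall>s\<in>carrier S. tensor_lact S R s (tensor_null S R #>\<^bsub>tensor_free S\<^esub> c)
        = tensor_ract S R (tensor_null S R #>\<^bsub>tensor_free S\<^esub> c) s) \<longleftrightarrow>
      (\<forall>s\<in>carrier S. lmult_frag s c - rmult_frag s c \<in> tensor_null S R)"
    if "Poly_Mapping.keys c \<subseteq> pairs" for c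
    using that by (simp add: lact ract tensor_coset_eq_iff keys_lmult_frag keys_rmult_frag)
  have "separable_extension R S \<longleftrightarrow> (\<exists>c. Poly_Mapping.keys c \<subseteq> pairs \<and>
      (\<forall>s\<in>carrier S. tensor_lact S R s (tensor_null S R #>\<^bsub>tensor_free S\<^esub> c)
        = tensor_ract S R (tensor_null S R #>\<^bsub>tensor_free S\<^esub> c) s) \<and>
      tensor_mult S (tensor_null S R #>\<^bsub>tensor_free S\<^esub> c) = \<one>)"
    unfolding separable_extension_def carrier_tensor using assms ring_axioms by blast
  also have "\<dots> \<longleftrightarrow> (\<exists>c. Poly_Mapping.keys c \<subseteq> pairs \<and>
      (\<forall>s\<in>carrier S. lmult_frag s c - rmult_frag s c \<in> tensor_null S R) \<and>
      frag_sum S (\<lambda>p. fst p \<otimes> snd p) c = \<one>)"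
    by (intro ex_cong1 conj_cong refl) (simp_all only: * mult)
  finally show ?thesis .
qed

section \<open>Elementary relations and evaluation of balanced maps\<close>

lemma tensor_null_sum:
  "(\<And>i. i \<in> I \<Longrightarrow> f i \<in> tensor_null S R) \<Longrightarrow> sum f I \<in> tensor_null S R"
  by (induction I rule: infinite_finite_induct) (auto simp: tensor_null_zero tensor_null_add)

lemma tensor_add_left:
  "\<lbrakk>a \<in> carrier S; b \<in> carrier S; d \<in> carrier S\<rbrakk>
    \<Longrightarrow> frag_of (a \<oplus> b, d) - frag_of (a, d) - frag_of (b, d) \<in> tensor_null S R"
  by (rule tensor_null_rel) (auto simp: tensor_rels_def)

lemma tensor_add_right:
  "\<lbrakk>a \<in> carrier S; b \<in> carrier S; d \<in> carrier S\<rbrakk>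
    \<Longrightarrow> frag_of (a, b \<oplus> d) - frag_of (a, b) - frag_of (a, d) \<in> tensor_null S R"
  by (rule tensor_null_rel) (auto simp: tensor_rels_def)

lemma tensor_balanced:
  "\<lbrakk>a \<in> carrier S; r \<in> R; b \<in> carrier S\<rbrakk>
    \<Longrightarrow> frag_of (a \<otimes> r, b) - frag_of (a, r \<otimes> b) \<in> tensor_null S R"
  by (rule tensor_null_rel) (auto simp: tensor_rels_def)

text \<open>For the sum 0 + 0 the additivity relation is the negative of the generator
  itself.\<close>

lemma tensor_zero_left: "b \<in> carrier S \<Longrightarrow> frag_of (\<zero>, b) \<in> tensor_null S R"
  using tensor_null_minus[OF tensor_add_left[of \<zero> \<zero> b]] by simp

lemma tensor_zero_right: "a \<in> carrier S \<Longrightarrow> frag_of (a, \<zero>) \<in> tensor_null S R"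
  using tensor_null_minus[OF tensor_add_right[of a \<zero> \<zero>]] by simp

text \<open>A balanced map kills the difference of the two actions, so an equation in the tensor
  product becomes one in \<open>H\<close>. This is how a separability element is exploited.\<close>

lemma frag_sum_balanced_commute:
  assumes H: "abelian_group H" and \<psi>: "balanced H \<psi>" and c: "Poly_Mapping.keys c \<subseteq> pairs"
    and s: "s \<in> carrier S" and comm: "lmult_frag s c - rmult_frag s c \<in> tensor_null S R"
  shows "frag_sum H (\<lambda>p. \<psi> (s \<otimes> fst p, snd p)) c = frag_sum H (\<lambda>p. \<psi> (fst p, snd p \<otimes> s)) c"
proof -
  interpret H: abelian_group H by (rule H)
  have \<psi>_closed: "\<psi> \<in> pairs \<rightarrow> carrier H" using \<psi> by (simp add: balanced_def)
  have keys: "Poly_Mapping.keys (lmult_frag s c) \<subseteq> pairs" "Poly_Mapping.keys (rmult_frag s c) \<subseteq> pairs"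
    using s c by (simp_all only: keys_lmult_frag keys_rmult_frag)
  have "frag_sum H \<psi> (lmult_frag s c)
      = frag_sum H \<psi> ((lmult_frag s c - rmult_frag s c) + rmult_frag s c)"
    by simp
  also have "\<dots> = frag_sum H \<psi> (rmult_frag s c)"
    using H.frag_sum_add[OF keys_diff_subset[OF keys] keys(2) \<psi>_closed]
      frag_sum_null[OF H \<psi> comm] H.frag_sum_closed[OF keys(2) \<psi>_closed] by simp
  finally have "frag_sum H \<psi> (lmult_frag s c) = frag_sum H \<psi> (rmult_frag s c)" .
  moreover have "(\<lambda>p. (s \<otimes> fst p, snd p)) \<in> pairs \<rightarrow> pairs" "(\<lambda>p. (fst p, snd p \<otimes> s)) \<in> pairs \<rightarrow> pairs"
    using s by auto
  note this[THEN H.frag_sum_frag_map, OF \<psi>_closed c]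
  ultimately show ?thesis unfolding lmult_frag_alt rmult_frag_alt by simp
qed

end

section \<open>Groupoids and unital partial actions\<close>

context groupoid
begin

lemma ginv_props:
  assumes g: "g \<in> arr G"
  shows "ginv G g \<in> arr G \<and> src G (ginv G g) = tgt G g \<and> tgt G (ginv G g) = src G g \<and>
    g \<bullet> ginv G g = tgt G g \<and> ginv G g \<bullet> g = src G g"
  unfolding ginv_def
proof (rule theI')
  let ?inv = "\<lambda>h. h \<in> arr G \<and> src G h = tgt G g \<and> tgt G h = src G g \<and> g \<bullet> h = tgt G g \<and> h \<bullet> g = src G g"
  obtain h where h: "?inv h" using inverse_exists[OF g] by blast
  show "\<exists>!h. ?inv h"
  proof (rule ex1I[where a = h], rule h)
    fix k assume k: "?inv k"
    have "k = k \<bullet> (g \<bullet> h)" using k h comp_src[of k] by simp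
    also have "\<dots> = (k \<bullet> g) \<bullet> h" using k h g comp_assoc[of k g h] by simp
    also have "\<dots> = h" using k h tgt_comp_left[of h] by simp
    finally show "k = h" .
  qed
qed

lemma ginv_closed [simp]: "g \<in> arr G \<Longrightarrow> ginv G g \<in> arr G"
  and src_ginv [simp]: "g \<in> arr G \<Longrightarrow> src G (ginv G g) = tgt G g"
  and tgt_ginv [simp]: "g \<in> arr G \<Longrightarrow> tgt G (ginv G g) = src G g"
  and comp_ginv [simp]: "g \<in> arr G \<Longrightarrow> g \<bullet> ginv G g = tgt G g"
  and ginv_comp [simp]: "g \<in> arr G \<Longrightarrow> ginv G g \<bullet> g = src G g"
  using ginv_props by auto

lemma ginv_eqI:
  assumes "g \<in> arr G" "h \<in> arr G" "src G g = tgt G h" "g \<bullet> h = tgt G g"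
  shows "ginv G g = h"
proof -
  have "h = (ginv G g \<bullet> g) \<bullet> h" using assms tgt_comp_left[of h] by simp
  also have "\<dots> = ginv G g \<bullet> (g \<bullet> h)" using assms by (intro comp_assoc) auto
  also have "\<dots> = ginv G g" using assms comp_src[of "ginv G g"] by simp
  finally show ?thesis by simp
qed

lemma ginv_ginv [simp]: "g \<in> arr G \<Longrightarrow> ginv G (ginv G g) = g"
  by (rule ginv_eqI) auto

lemma obj_arr: "y \<in> objs G \<Longrightarrow> y \<in> arr G"
  and src_of_obj [simp]: "y \<in> objs G \<Longrightarrow> src G y = y"
  and tgt_of_obj [simp]: "y \<in> objs G \<Longrightarrow> tgt G y = y"
  by (auto simp: objs_def)

lemma obj_comp [simp]: "\<lbrakk>y \<in> objs G; g \<in> arr G; tgt G g = y\<rbrakk> \<Longrightarrow> y \<bullet> g = g"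
  and comp_obj [simp]: "\<lbrakk>y \<in> objs G; g \<in> arr G; src G g = y\<rbrakk> \<Longrightarrow> g \<bullet> y = g"
  using tgt_comp_left[of g] comp_src[of g] by auto

lemma ginv_obj [simp]: "y \<in> objs G \<Longrightarrow> ginv G y = y"
  by (rule ginv_eqI) (auto simp: obj_arr)

lemma comp_ginv_cancel_left [simp]:
  "\<lbrakk>g \<in> arr G; k \<in> arr G; tgt G k = tgt G g\<rbrakk> \<Longrightarrow> g \<bullet> (ginv G g \<bullet> k) = k"
  using comp_assoc[of g "ginv G g" k] tgt_comp_left[of k] by simp

lemma ginv_comp_cancel_left [simp]:
  "\<lbrakk>g \<in> arr G; k \<in> arr G; src G g = tgt G k\<rbrakk> \<Longrightarrow> ginv G g \<bullet> (g \<bullet> k) = k"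
  using comp_assoc[of "ginv G g" g k] tgt_comp_left[of k] by simp

lemma comp_ginv_cancel_right [simp]:
  "\<lbrakk>g \<in> arr G; k \<in> arr G; src G k = src G g\<rbrakk> \<Longrightarrow> (k \<bullet> ginv G g) \<bullet> g = k"
  using comp_assoc[of k "ginv G g" g] comp_src[of k] by simp

lemma ginv_comp_cancel_right [simp]:
  "\<lbrakk>g \<in> arr G; k \<in> arr G; src G k = tgt G g\<rbrakk> \<Longrightarrow> (k \<bullet> g) \<bullet> ginv G g = k"
  using comp_assoc[of k g "ginv G g"] comp_src[of k] by simp

lemma ginv_of_comp:
  "\<lbrakk>g \<in> arr G; h \<in> arr G; src G g = tgt G h\<rbrakk> \<Longrightarrow> ginv G (g \<bullet> h) = ginv G h \<bullet> ginv G g"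
  by (rule ginv_eqI) (auto simp: comp_closed src_comp tgt_comp comp_assoc)

end

text \<open>The groupoid and its isotropy group at an object are both instances, so the trace
  criterion is proved once and applied to both. The direct sum condition supplies the orthogonality
  of the object idempotents.\<close>

locale unital_action =
  partial_action G A D \<alpha>
  for G :: "('g, 'm) groupoid_data_scheme" and A :: "('a, 'n) ring_scheme" (structure)
    and D :: "'g \<Rightarrow> 'a set" and \<alpha> :: "'g \<Rightarrow> 'a \<Rightarrow> 'a" +
  assumes finite_arr: "finite (arr G)"
    and direct_sum: "is_direct_sum A (objs G) D"
    and unital: "g \<in> arr G \<Longrightarrow> \<exists>e. is_unit_idem A D g e"
begin

abbreviation e :: "'g \<Rightarrow> 'a" where
  "e g \<equiv> unit_idem A D g"

text \<open>The extension of \<open>\<alpha> g\<close> to \<open>A\<close> by zero on the ideal complementary to its domain.\<close>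

definition act :: "'g \<Rightarrow> 'a \<Rightarrow> 'a" where
  "act g a = \<alpha> g (a \<otimes> e (ginv G g))"

lemma finite_objs [simp]: "finite (objs G)"
  using finite_subset[OF _ finite_arr, of "objs G"] obj_arr by blast

text \<open>Both elements are central identities of the same ideal, so each absorbs the other: u =
  uv = vu = v.\<close>

lemma is_unit_idem_unique:
  assumes "is_unit_idem A D g u" "is_unit_idem A D g v"
  shows "u = v"
proof -
  have absorb: "u \<otimes> v = u" if uv: "is_unit_idem A D g u" "is_unit_idem A D g v" for u v
  proof -
    have u: "u \<in> carrier A" "u \<otimes> u = u" "D g = {a \<otimes> u |a. a \<in> carrier A}"
      and v: "v \<in> carrier A" "v \<otimes> v = v" "D g = {a \<otimes> v |a. a \<in> carrier A}"
      using uv by (simp_all add: is_unit_idem_def rng_center_def)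
    from u have "u \<in> D g" by (metis (mono_tags, lifting) mem_Collect_eq)
    then obtain a where "u = a \<otimes> v" "a \<in> carrier A" unfolding v(3) by blast
    then show ?thesis using v(1,2) m_assoc[of a v v] by simp
  qed
  have "u \<otimes> v = v \<otimes> u" using assms unfolding is_unit_idem_def rng_center_def by blast
  with absorb assms show ?thesis by metis
qed

lemma is_unit_idem: "g \<in> arr G \<Longrightarrow> is_unit_idem A D g (e g)"
  unfolding unit_idem_def using unital is_unit_idem_unique by (metis theI)

lemma e_closed [simp]: "g \<in> arr G \<Longrightarrow> e g \<in> carrier A"
  and e_idem [simp]: "g \<in> arr G \<Longrightarrow> e g \<otimes> e g = e g"
  and e_comm: "\<lbrakk>g \<in> arr G; a \<in> carrier A\<rbrakk> \<Longrightarrow> e g \<otimes> a = a \<otimes> e g"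
  using is_unit_idem[of g] unfolding is_unit_idem_def rng_center_def by blast+

text \<open>Membership in an ideal becomes an equation, so that domain conditions are settled by
  computing with central idempotents.\<close>

lemma D_iff:
  assumes g: "g \<in> arr G"
  shows "a \<in> D g \<longleftrightarrow> a \<in> carrier A \<and> a \<otimes> e g = a"
proof
  assume "a \<in> D g"
  then obtain b where "b \<in> carrier A" "a = b \<otimes> e g"
    using is_unit_idem[OF g] unfolding is_unit_idem_def by blast
  then show "a \<in> carrier A \<and> a \<otimes> e g = a" using g by (simp add: m_assoc m_closed)
next
  assume "a \<in> carrier A \<and> a \<otimes> e g = a"
  then show "a \<in> D g"
    using is_unit_idem[OF g] unfolding is_unit_idem_def by (metis (mono_tags, lifting) mem_Collect_eq)
qed

lemma D_carrier: "\<lbrakk>g \<in> arr G; a \<in> D g\<rbrakk> \<Longrightarrow> a \<in> carrier A"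
  by (simp add: D_iff)

lemma D_e: "\<lbrakk>g \<in> arr G; a \<in> carrier A\<rbrakk> \<Longrightarrow> a \<otimes> e g \<in> D g"
  by (simp add: D_iff m_assoc m_closed)

lemma e_D: "g \<in> arr G \<Longrightarrow> e g \<in> D g"
  by (simp add: D_iff)

lemma D_zero: "g \<in> arr G \<Longrightarrow> \<zero> \<in> D g"
  by (simp add: D_iff)

lemma D_add: "\<lbrakk>g \<in> arr G; a \<in> D g; b \<in> D g\<rbrakk> \<Longrightarrow> a \<oplus> b \<in> D g"
  by (simp add: D_iff l_distr)

lemma D_mult_left: "\<lbrakk>g \<in> arr G; a \<in> carrier A; b \<in> D g\<rbrakk> \<Longrightarrow> a \<otimes> b \<in> D g"
  by (simp add: D_iff m_assoc m_closed)

lemma D_mult_right: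
  assumes "g \<in> arr G" "a \<in> carrier A" "b \<in> D g"
  shows "b \<otimes> a \<in> D g"
proof -
  have "b \<otimes> a \<otimes> e g = b \<otimes> (e g \<otimes> a)" using assms by (simp add: D_iff m_assoc e_comm)
  also have "\<dots> = b \<otimes> a" using assms by (simp add: D_iff flip: m_assoc)
  finally show ?thesis using assms by (simp add: D_iff m_closed)
qed

lemma e_e_D: "\<lbrakk>g \<in> arr G; h \<in> arr G\<rbrakk> \<Longrightarrow> e g \<otimes> e h \<in> D g \<and> e g \<otimes> e h \<in> D h"
  by (simp add: D_e D_mult_right e_D)

lemma D_minus: "\<lbrakk>g \<in> arr G; a \<in> D g\<rbrakk> \<Longrightarrow> \<ominus> a \<in> D g"
proof -
  assume g: "g \<in> arr G" and a: "a \<in> D g"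
  then have c: "a \<in> carrier A" by (rule D_carrier)
  have "(\<ominus> a) \<otimes> e g \<oplus> a \<otimes> e g = \<zero>"
    using g c l_distr[of "\<ominus> a" a "e g"] by (simp add: l_neg)
  then have "(\<ominus> a) \<otimes> e g = \<ominus> (a \<otimes> e g)" using g c by (simp add: add.inv_equality m_closed)
  then show ?thesis using g a by (simp add: D_iff)
qed

lemma D_finsum: "\<lbrakk>g \<in> arr G; finite I; \<And>i. i \<in> I \<Longrightarrow> f i \<in> D g\<rbrakk> \<Longrightarrow> finsum A f I \<in> D g"
proof -
  assume g: "g \<in> arr G" and "finite I" and "\<And>i. i \<in> I \<Longrightarrow> f i \<in> D g"
  from this(2,3) show ?thesis
  proof (induction I rule: finite_induct)
    case (insert i I)
    then have "finsum A f (insert i I) = f i \<oplus> finsum A f I"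
      using D_carrier[OF g] by (intro finsum_insert) auto
    then show ?case using insert D_add[OF g] by auto
  qed (simp add: D_zero g)
qed

lemma D_subset_tgt: "g \<in> arr G \<Longrightarrow> D g \<subseteq> D (tgt G g)"
  using ideal_dom[of g] additive_subgroup.a_subset by (fastforce simp: rng_ideal_def)

lemma e_tgt [simp]: "g \<in> arr G \<Longrightarrow> e g \<otimes> e (tgt G g) = e g"
  using e_D[of g] D_subset_tgt[of g] D_iff[of "tgt G g"] tgt_obj[of g] obj_arr by auto

section \<open>The extension of the partial action by zero\<close>

lemma \<alpha>_closed: "\<lbrakk>g \<in> arr G; a \<in> D (ginv G g)\<rbrakk> \<Longrightarrow> \<alpha> g a \<in> D g"
  using iso_bij[of g] by (auto simp: bij_betw_def)

lemma act_closed: "\<lbrakk>g \<in> arr G; a \<in> carrier A\<rbrakk> \<Longrightarrow> act g a \<in> D g"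
  unfolding act_def by (intro \<alpha>_closed D_e) auto

lemma act_carrier [simp]: "\<lbrakk>g \<in> arr G; a \<in> carrier A\<rbrakk> \<Longrightarrow> act g a \<in> carrier A"
  using act_closed D_carrier by blast

lemma act_e [simp]: "\<lbrakk>g \<in> arr G; a \<in> carrier A\<rbrakk> \<Longrightarrow> act g a \<otimes> e g = act g a"
  using act_closed D_iff by blast

lemma e_act [simp]: "\<lbrakk>g \<in> arr G; a \<in> carrier A\<rbrakk> \<Longrightarrow> e g \<otimes> act g a = act g a"
  by (simp add: e_comm)

lemma act_add: "\<lbrakk>g \<in> arr G; a \<in> carrier A; b \<in> carrier A\<rbrakk> \<Longrightarrow> act g (a \<oplus> b) = act g a \<oplus> act g b"
  unfolding act_def using iso_add[of g "a \<otimes> e (ginv G g)" "b \<otimes> e (ginv G g)"]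
  by (simp add: l_distr D_e)

lemma act_mult:
  assumes "g \<in> arr G" "a \<in> carrier A" "b \<in> carrier A"
  shows "act g (a \<otimes> b) = act g a \<otimes> act g b"
proof -
  let ?e = "e (ginv G g)"
  have "a \<otimes> ?e \<otimes> (b \<otimes> ?e) = a \<otimes> (?e \<otimes> b \<otimes> ?e)"
    using assms by (simp add: m_assoc m_closed)
  also have "\<dots> = a \<otimes> b \<otimes> ?e"
    using assms e_comm[of "ginv G g" b] by (simp add: m_assoc m_closed)
  finally show ?thesis
    unfolding act_def using assms iso_mult[of g "a \<otimes> ?e" "b \<otimes> ?e"] by (simp add: D_e)
qed

lemma act_zero [simp]: "g \<in> arr G \<Longrightarrow> act g \<zero> = \<zero>"
  using act_add[of g \<zero> \<zero>] act_carrier[of g \<zero>] by (metis add.l_cancel_one' l_zero zero_closed)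

lemma act_finsum:
  "\<lbrakk>finite I; g \<in> arr G; f \<in> I \<rightarrow> carrier A\<rbrakk> \<Longrightarrow> act g (finsum A f I) = finsum A (\<lambda>i. act g (f i)) I"
  by (induction I rule: finite_induct) (auto simp: act_add Pi_iff)

lemma act_D: "\<lbrakk>g \<in> arr G; a \<in> D (ginv G g)\<rbrakk> \<Longrightarrow> act g a = \<alpha> g a"
  unfolding act_def using D_iff[of "ginv G g" a] by simp

lemma act_obj [simp]: "\<lbrakk>y \<in> objs G; a \<in> carrier A\<rbrakk> \<Longrightarrow> act y a = a \<otimes> e y"
  unfolding act_def by (simp add: obj_arr act_obj D_e)

text \<open>Surjectivity of \<alpha>_g gives a preimage a of 1_g, and a = a 1_{g^-1} shows that the
  image of 1_{g^-1} multiplies 1_g to 1_g. That image lies in A_g, so it equals 1_g.\<close>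

lemma act_unit [simp]:
  assumes g: "g \<in> arr G"
  shows "act g (e (ginv G g)) = e g"
proof -
  let ?u = "act g (e (ginv G g))"
  have "e g \<in> \<alpha> g ` D (ginv G g)" using iso_bij[OF g] e_D[OF g] by (simp add: bij_betw_def)
  then obtain a where a: "a \<in> D (ginv G g)" "e g = act g a" using act_D[OF g] by auto
  then have "e g \<otimes> ?u = e g"
    using g act_mult[of g a "e (ginv G g)"] D_iff[of "ginv G g" a] by simp
  then show ?thesis using g e_act[of g "e (ginv G g)"] by simp
qed

lemma e_ginv_src [simp]: "g \<in> arr G \<Longrightarrow> e (ginv G g) \<otimes> e (src G g) = e (ginv G g)"
  using e_tgt[of "ginv G g"] by simp

lemma act_src:
  assumes "g \<in> arr G" "a \<in> carrier A"
  shows "act g (a \<otimes> e (src G g)) = act g a"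
proof -
  have "src G g \<in> arr G" using assms src_obj obj_arr by blast
  then show ?thesis
    unfolding act_def using assms e_comm[of "src G g" "e (ginv G g)"] by (simp add: m_assoc)
qed

lemma act_src_unit: "g \<in> arr G \<Longrightarrow> act g (e (src G g)) = e g"
  using act_unit[of g] e_comm[of "src G g" "e (ginv G g)"] src_obj obj_arr
  unfolding act_def by simp

lemma \<alpha>_ginv:
  assumes g: "g \<in> arr G" and a: "a \<in> D (ginv G g)"
  shows "\<alpha> (ginv G g) (\<alpha> g a) = a"
proof -
  have "\<alpha> g a \<in> D (ginv G (ginv G g))" using \<alpha>_closed assms by simp
  then have "\<alpha> (ginv G g \<bullet>\<^bsub>G\<^esub> g) a = \<alpha> (ginv G g) (\<alpha> g a)"
    using act_comp[of "ginv G g" g a] assms by simp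
  moreover have "\<alpha> (src G g) a = a"
    using partial_action.act_obj[OF partial_action_axioms, of "src G g" a] D_subset_tgt[of "ginv G g"] a g src_obj by auto
  ultimately show ?thesis using g by simp
qed

text \<open>The idempotent form of \<alpha>_{h^-1}(A_h \<inter> A_{g^-1}) = A_{h^-1} \<inter>
  A_{(gh)^-1}. The composition axiom for g, h gives one inclusion; the other is the same axiom for
  the composable pair gh, h^-1, whose product is g.\<close>

lemma act_e_inter:
  assumes g: "g \<in> arr G" and h: "h \<in> arr G" and gh: "src G g = tgt G h"
  shows "act (ginv G h) (e (ginv G g)) = e (ginv G h) \<otimes> e (ginv G (g \<bullet>\<^bsub>G\<^esub> h))"
    (is "?c = ?d")
proof -
  let ?k = "g \<bullet>\<^bsub>G\<^esub> h"
  have k: "?k \<in> arr G" "src G ?k = src G h" using g h gh comp_closed src_comp by auto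
  have 1: "?c \<in> D (ginv G ?k)"
  proof -
    let ?b = "e (ginv G g) \<otimes> e h"
    have b: "?b \<in> D h" "?b \<in> D (ginv G g)"
      using g h by (auto simp: e_e_D)
    have eq: "?c = \<alpha> (ginv G h) ?b" unfolding act_def using h by simp
    then have c: "?c \<in> D (ginv G h)" using b h \<alpha>_closed[of "ginv G h" ?b] by simp
    have "\<alpha> h ?c = ?b" using \<alpha>_ginv[of "ginv G h" ?b] eq b h by simp
    then show ?thesis using act_comp[of g h ?c] g h gh b c by simp
  qed
  \<comment> \<open>The reverse inclusion: \<open>\<alpha> h ?d\<close> lies in A_{g^-1}, and
    pulling the equation that expresses this back along h^-1 gives the claim.\<close>
  have 2: "?d = ?d \<otimes> ?c"
  proof -
    have d: "?d \<in> D (ginv G h)" "?d \<in> D (ginv G ?k)"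
      using k h by (auto simp: e_e_D)
    have \<alpha>d: "\<alpha> h ?d \<in> D h" using d h \<alpha>_closed by blast
    have "\<alpha> (ginv G h) (\<alpha> h ?d) = ?d" using \<alpha>_ginv[OF h] d by simp
    then have "\<alpha> h ?d \<in> D (ginv G (?k \<bullet>\<^bsub>G\<^esub> ginv G h))"
      using act_comp[of ?k "ginv G h" "\<alpha> h ?d"] \<alpha>d d k h by simp
    then have "\<alpha> h ?d \<in> D (ginv G g)" using g h gh by simp
    then have "\<alpha> h ?d \<otimes> e (ginv G g) = \<alpha> h ?d" using g D_iff[of "ginv G g"] by simp
    then have "act (ginv G h) (\<alpha> h ?d) \<otimes> ?c = act (ginv G h) (\<alpha> h ?d)"
      using act_mult[of "ginv G h" "\<alpha> h ?d" "e (ginv G g)"] g h \<alpha>d D_carrier by simp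
    moreover have "act (ginv G h) (\<alpha> h ?d) = ?d"
      using act_D[of "ginv G h" "\<alpha> h ?d"] \<alpha>d h \<alpha>_ginv[OF h] d by simp
    ultimately show ?thesis by simp
  qed
  have c: "?c \<in> carrier A" using g h by simp
  have "?d \<otimes> ?c = ?c \<otimes> e (ginv G ?k) \<otimes> e (ginv G h)"
    using c g h k e_comm[of "ginv G h" "e (ginv G ?k) \<otimes> ?c"] e_comm[of "ginv G ?k" ?c]
    by (simp add: m_assoc m_closed)
  also have "\<dots> = ?c" using 1 k h g D_iff[of "ginv G ?k" ?c] by simp
  finally show ?thesis using 2 by simp
qed

text \<open>Cutting a down to the common domain of both composites makes the axiom applicable. The
  cut-off idempotent is then carried forward by \<open>act\<close> of gh, where it turns into the
  factor 1_g on the left.\<close>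

lemma act_act:
  assumes g: "g \<in> arr G" and h: "h \<in> arr G" and gh: "src G g = tgt G h" and a: "a \<in> carrier A"
  shows "act g (act h a) = e g \<otimes> act (g \<bullet>\<^bsub>G\<^esub> h) a"
proof -
  let ?k = "g \<bullet>\<^bsub>G\<^esub> h"
  have k: "?k \<in> arr G" "src G ?k = src G h" "tgt G ?k = tgt G g"
    using g h gh comp_closed src_comp tgt_comp by auto
  let ?c = "e (ginv G h) \<otimes> e (ginv G ?k)"
  \<comment> \<open>\<open>?b\<close> lies in A_{h^-1} \<inter> A_{(gh)^-1}, and by
    \<open>act_e_inter\<close> its image under \<alpha>_h falls into the domain of
    \<alpha>_g.\<close>
  let ?b = "a \<otimes> ?c"
  have b: "?b \<in> D (ginv G h)" "?b \<in> D (ginv G ?k)"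
    using a h k by (simp_all add: D_mult_left e_e_D)
  have c: "?c \<in> carrier A" using h k m_closed by simp
  have ec: "e (ginv G g) \<otimes> e h \<in> D (ginv G (ginv G h))"
    using g h by (auto intro: D_e)
  have "?c = \<alpha> (ginv G h) (e (ginv G g) \<otimes> e h)"
    using act_e_inter[OF g h gh] h by (simp add: act_def)
  then have "\<alpha> h ?c = e (ginv G g) \<otimes> e h"
    using \<alpha>_ginv[OF ginv_closed[OF h] ec] h by simp
  moreover have "act h ?c = \<alpha> h ?c"
    using h k by (intro act_D) (simp_all add: e_e_D)
  ultimately have "act h ?c = e (ginv G g) \<otimes> e h" by simp
  then have "act h ?b = act h a \<otimes> (e h \<otimes> e (ginv G g))"
    using g h a c e_comm[of h "e (ginv G g)"] by (simp add: act_mult)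
  also have "\<dots> = act h a \<otimes> e (ginv G g)"
    using g h a m_assoc[of "act h a" "e h" "e (ginv G g)"] by simp
  finally have 1: "\<alpha> h ?b = act h a \<otimes> e (ginv G g)"
    using act_D[OF h b(1)] by simp
  then have "\<alpha> h ?b \<in> D (ginv G g)" using g h a by (simp add: D_e)
  then have "\<alpha> ?k ?b = \<alpha> g (\<alpha> h ?b)" using act_comp[OF g h gh b(1)] by simp
  then have "act g (act h a) = act ?k ?b"
    using 1 act_D[OF k(1) b(2)] by (simp add: act_def)
  also have "\<dots> = act ?k a \<otimes> (act ?k (e (ginv G h)) \<otimes> e ?k)"
    using a c h k by (simp add: act_mult)
  \<comment> \<open>This is \<open>act_e_inter\<close> for the pair h, k^-1 with k = gh, since the
    inverse of h k^-1 is g.\<close>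
  also have "act ?k (e (ginv G h)) = e ?k \<otimes> e g"
  proof -
    have "ginv G (h \<bullet>\<^bsub>G\<^esub> ginv G ?k) = g"
      using g h gh k by (simp add: ginv_of_comp)
    then show ?thesis using act_e_inter[of h "ginv G ?k"] h k by simp
  qed
  also have "act ?k a \<otimes> (e ?k \<otimes> e g \<otimes> e ?k) = act ?k a \<otimes> e ?k \<otimes> e ?k \<otimes> e g"
    using a g k(1) e_comm[of g "e ?k"] by (simp only: m_assoc m_closed e_closed act_carrier)
  also have "\<dots> = act ?k a \<otimes> e g" using a k(1) by simp
  also have "\<dots> = e g \<otimes> act ?k a" using a g k by (simp add: e_comm[of g])
  finally show ?thesis .
qed

end

section \<open>The partial skew groupoid ring\<close>

context unital_action
begin

section \<open>Coefficients and products in the skew ring\<close>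

abbreviation S :: "('g \<Rightarrow> 'a) ring" where
  "S \<equiv> skew_ring G A D \<alpha>"

definition single :: "'a \<Rightarrow> 'g \<Rightarrow> 'g \<Rightarrow> 'a" where
  "single a g = (\<lambda>k. if k = g then a else \<zero>)"

definition factorizations :: "'g \<Rightarrow> ('g \<times> 'g) set" where
  "factorizations k = {(g, h). g \<in> arr G \<and> h \<in> arr G \<and> src G g = tgt G h \<and> g \<bullet>\<^bsub>G\<^esub> h = k}"

lemma factorizationsE:
  assumes "p \<in> factorizations k"
  obtains g h where "p = (g, h)" "g \<in> arr G" "h \<in> arr G" "src G g = tgt G h" "g \<bullet>\<^bsub>G\<^esub> h = k"
  using assms by (auto simp: factorizations_def)

lemma finite_factorizations [simp]: "finite (factorizations k)"
  by (rule finite_subset[OF _ finite_cartesian_product[OF finite_arr finite_arr]])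
    (auto simp: factorizations_def)

lemma skew_carrier_iff:
  "f \<in> carrier S \<longleftrightarrow> (\<forall>g\<in>arr G. f g \<in> D g) \<and> (\<forall>g. g \<notin> arr G \<longrightarrow> f g = \<zero>)"
proof -
  have "finite {g. f g \<noteq> \<zero>}" if "\<forall>g. g \<notin> arr G \<longrightarrow> f g = \<zero>"
    using that by (intro finite_subset[OF _ finite_arr]) auto
  then show ?thesis by (auto simp: skew_ring_def)
qed

lemma skew_D: "\<lbrakk>f \<in> carrier S; g \<in> arr G\<rbrakk> \<Longrightarrow> f g \<in> D g"
  by (simp add: skew_carrier_iff)

lemma skew_outside: "\<lbrakk>f \<in> carrier S; g \<notin> arr G\<rbrakk> \<Longrightarrow> f g = \<zero>"
  by (simp add: skew_carrier_iff)

lemma skew_carrier [simp]: "f \<in> carrier S \<Longrightarrow> f g \<in> carrier A"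
  by (metis skew_D skew_outside D_carrier zero_closed)

lemma skew_add: "(f \<oplus>\<^bsub>S\<^esub> f') k = f k \<oplus> f' k"
  by (simp add: skew_ring_def)

lemma skew_zero: "\<zero>\<^bsub>S\<^esub> = (\<lambda>k. \<zero>)"
  by (simp add: skew_ring_def)

lemma skew_zero_apply: "\<zero>\<^bsub>S\<^esub> k = \<zero>"
  by (simp add: skew_zero)

text \<open>The index set in \<open>skew_ring\<close> depends on the supports of the two factors.
  The additional terms over all factorizations of \<open>k\<close> vanish, and the fixed index set
  lets products with different factors be added term by term.\<close>

lemma skew_mult:
  assumes "f \<in> carrier S" "f' \<in> carrier S"
  shows "(f \<otimes>\<^bsub>S\<^esub> f') k = finsum A (\<lambda>(g, h). f g \<otimes> act g (f' h)) (factorizations k)"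
proof -
  let ?I = "{(g, h). g \<in> arr G \<and> h \<in> arr G \<and> f g \<noteq> \<zero> \<and> f' h \<noteq> \<zero> \<and>
                 src G g = tgt G h \<and> g \<bullet>\<^bsub>G\<^esub> h = k}"
  have "finsum A (\<lambda>(g, h). f g \<otimes> act g (f' h)) ?I = finsum A (\<lambda>(g, h). f g \<otimes> act g (f' h)) (factorizations k)"
  proof (rule add.finprod_mono_neutral_cong_left)
    show "?I \<subseteq> factorizations k" by (auto simp: factorizations_def)
    show "(case p of (g, h) \<Rightarrow> f g \<otimes> act g (f' h)) = \<zero>" if "p \<in> factorizations k - ?I" for p
      using that assms by (auto simp: factorizations_def)
    show "(\<lambda>(g, h). f g \<otimes> act g (f' h)) \<in> factorizations k \<rightarrow> carrier A"
      using assms by (auto simp: factorizations_def intro!: m_closed)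
  qed auto
  then show ?thesis by (simp add: skew_ring_def act_def)
qed

lemma factor_closed:
  "\<lbrakk>f \<in> carrier S; f' \<in> carrier S; (g, h) \<in> factorizations k\<rbrakk> \<Longrightarrow> f g \<otimes> act g (f' h) \<in> carrier A"
  by (auto simp: factorizations_def intro!: m_closed)

lemma act_ginv_right: "\<lbrakk>h \<in> arr G; b \<in> D h\<rbrakk> \<Longrightarrow> act h (act (ginv G h) b) = b"
proof -
  assume h: "h \<in> arr G" and b: "b \<in> D h"
  then have c: "b \<in> carrier A" "b \<otimes> e h = b" by (auto simp: D_iff)
  have "act h (act (ginv G h) b) = e h \<otimes> (b \<otimes> e (tgt G h))"
    using act_act[of h "ginv G h" b] h c tgt_obj[of h] by simp
  also have "\<dots> = b"
    using h c e_comm[of h b] obj_arr[OF tgt_obj[OF h]] by (simp flip: m_assoc)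
      (metis D_subset_tgt D_iff b subsetD)
  finally show ?thesis .
qed

text \<open>Writing b = act h (act h^-1 b), the composition law expresses act g b as 1_g times a
  value of \<open>act\<close> at gh. This puts the coefficients of a product into the right
  ideals.\<close>

lemma act_D_comp:
  assumes "g \<in> arr G" "h \<in> arr G" "src G g = tgt G h" "b \<in> D h"
  shows "act g b \<in> D (g \<bullet>\<^bsub>G\<^esub> h)"
proof -
  have b: "b \<in> carrier A" using assms D_carrier by blast
  then have "act g b = e g \<otimes> act (g \<bullet>\<^bsub>G\<^esub> h) (act (ginv G h) b)"
    using assms act_act[of g h "act (ginv G h) b"] act_ginv_right[of h b] by simp
  then show ?thesis using assms b comp_closed by (simp add: D_mult_left act_closed)
qed

lemma skew_mult_closed:
  assumes f: "f \<in> carrier S" and f': "f' \<in> carrier S"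
  shows "f \<otimes>\<^bsub>S\<^esub> f' \<in> carrier S"
  unfolding skew_carrier_iff
proof (intro conjI ballI allI impI)
  fix k assume k: "k \<in> arr G"
  show "(f \<otimes>\<^bsub>S\<^esub> f') k \<in> D k"
    unfolding skew_mult[OF f f'] using k
  proof (rule D_finsum)
    fix p assume "p \<in> factorizations k"
    then show "(case p of (g, h) \<Rightarrow> f g \<otimes> act g (f' h)) \<in> D k"
      using f f' k by (elim factorizationsE) (auto simp: D_mult_left act_D_comp skew_D)
  qed simp
next
  fix k assume "k \<notin> arr G"
  then have "factorizations k = {}" using comp_closed by (auto simp: factorizations_def)
  then show "(f \<otimes>\<^bsub>S\<^esub> f') k = \<zero>" by (simp add: skew_mult[OF f f'])
qed

lemma skew_add_closed: "\<lbrakk>f \<in> carrier S; f' \<in> carrier S\<rbrakk> \<Longrightarrow> f \<oplus>\<^bsub>S\<^esub> f' \<in> carrier S"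
  by (simp add: skew_carrier_iff skew_add D_add)

lemma skew_zero_closed: "\<zero>\<^bsub>S\<^esub> \<in> carrier S"
  by (simp add: skew_carrier_iff skew_zero D_zero)

lemma skew_abelian_group: "abelian_group S"
proof (rule abelian_groupI)
  fix f assume f: "f \<in> carrier S"
  have "(\<lambda>g. \<ominus> f g) \<in> carrier S" "(\<lambda>g. \<ominus> f g) \<oplus>\<^bsub>S\<^esub> f = \<zero>\<^bsub>S\<^esub>"
    using f by (auto simp: skew_carrier_iff D_minus skew_zero_apply fun_eq_iff skew_add l_neg D_carrier)
  then show "\<exists>f'\<in>carrier S. f' \<oplus>\<^bsub>S\<^esub> f = \<zero>\<^bsub>S\<^esub>" by blast
qed (simp_all add: skew_add_closed skew_zero_closed fun_eq_iff skew_add skew_zero_apply a_ac)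

lemma skew_l_distr:
  assumes "f \<in> carrier S" "f' \<in> carrier S" "f'' \<in> carrier S"
  shows "(f \<oplus>\<^bsub>S\<^esub> f') \<otimes>\<^bsub>S\<^esub> f'' = f \<otimes>\<^bsub>S\<^esub> f'' \<oplus>\<^bsub>S\<^esub> f' \<otimes>\<^bsub>S\<^esub> f''"
proof
  fix k
  have "finsum A (\<lambda>(g, h). (f \<oplus>\<^bsub>S\<^esub> f') g \<otimes> act g (f'' h)) (factorizations k)
      = finsum A (\<lambda>p. (case p of (g, h) \<Rightarrow> f g \<otimes> act g (f'' h)) \<oplus> (case p of (g, h) \<Rightarrow> f' g \<otimes> act g (f'' h))) (factorizations k)"
    by (rule finsum_cong')
      (use assms in \<open>auto simp: skew_add l_distr factor_closed elim!: factorizationsE intro!: m_closed\<close>)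
  also have "\<dots> = (f \<otimes>\<^bsub>S\<^esub> f'') k \<oplus> (f' \<otimes>\<^bsub>S\<^esub> f'') k"
    using assms by (subst finsum_addf) (auto simp: skew_mult factor_closed)
  finally show "((f \<oplus>\<^bsub>S\<^esub> f') \<otimes>\<^bsub>S\<^esub> f'') k = (f \<otimes>\<^bsub>S\<^esub> f'' \<oplus>\<^bsub>S\<^esub> f' \<otimes>\<^bsub>S\<^esub> f'') k"
    using assms by (simp add: skew_mult skew_add_closed skew_add)
qed

lemma skew_r_distr:
  assumes "f \<in> carrier S" "f' \<in> carrier S" "f'' \<in> carrier S"
  shows "f'' \<otimes>\<^bsub>S\<^esub> (f \<oplus>\<^bsub>S\<^esub> f') = f'' \<otimes>\<^bsub>S\<^esub> f \<oplus>\<^bsub>S\<^esub> f'' \<otimes>\<^bsub>S\<^esub> f'"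
proof
  fix k
  have "finsum A (\<lambda>(g, h). f'' g \<otimes> act g ((f \<oplus>\<^bsub>S\<^esub> f') h)) (factorizations k)
      = finsum A (\<lambda>p. (case p of (g, h) \<Rightarrow> f'' g \<otimes> act g (f h)) \<oplus> (case p of (g, h) \<Rightarrow> f'' g \<otimes> act g (f' h))) (factorizations k)"
    by (rule finsum_cong')
      (use assms in \<open>auto simp: skew_add r_distr act_add factor_closed elim!: factorizationsE intro!: m_closed\<close>)
  also have "\<dots> = (f'' \<otimes>\<^bsub>S\<^esub> f) k \<oplus> (f'' \<otimes>\<^bsub>S\<^esub> f') k"
    using assms by (subst finsum_addf) (auto simp: skew_mult factor_closed)
  finally show "(f'' \<otimes>\<^bsub>S\<^esub> (f \<oplus>\<^bsub>S\<^esub> f')) k = (f'' \<otimes>\<^bsub>S\<^esub> f \<oplus>\<^bsub>S\<^esub> f'' \<otimes>\<^bsub>S\<^esub> f') k"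
    using assms by (simp add: skew_mult skew_add_closed skew_add)
qed

lemma skew_l_zero: "f \<in> carrier S \<Longrightarrow> \<zero>\<^bsub>S\<^esub> \<otimes>\<^bsub>S\<^esub> f = \<zero>\<^bsub>S\<^esub>"
  and skew_r_zero: "f \<in> carrier S \<Longrightarrow> f \<otimes>\<^bsub>S\<^esub> \<zero>\<^bsub>S\<^esub> = \<zero>\<^bsub>S\<^esub>"
proof -
  interpret S: abelian_group S by (rule skew_abelian_group)
  show "\<zero>\<^bsub>S\<^esub> \<otimes>\<^bsub>S\<^esub> f = \<zero>\<^bsub>S\<^esub>" if "f \<in> carrier S"
    using skew_l_distr[of "\<zero>\<^bsub>S\<^esub>" "\<zero>\<^bsub>S\<^esub>" f] that skew_mult_closed[of "\<zero>\<^bsub>S\<^esub>" f]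
    by (metis S.add.l_cancel_one' S.zero_closed S.l_zero)
  show "f \<otimes>\<^bsub>S\<^esub> \<zero>\<^bsub>S\<^esub> = \<zero>\<^bsub>S\<^esub>" if "f \<in> carrier S"
    using skew_r_distr[of "\<zero>\<^bsub>S\<^esub>" "\<zero>\<^bsub>S\<^esub>" f] that skew_mult_closed[of f "\<zero>\<^bsub>S\<^esub>"]
    by (metis S.add.l_cancel_one' S.zero_closed S.l_zero)
qed

lemma single_closed: "\<lbrakk>g \<in> arr G; a \<in> D g\<rbrakk> \<Longrightarrow> single a g \<in> carrier S"
  by (auto simp: skew_carrier_iff single_def D_zero)

lemma skew_finsum_apply:
  assumes "finite I" "f \<in> I \<rightarrow> carrier S"
  shows "finsum S f I k = finsum A (\<lambda>i. f i k) I"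
proof -
  interpret S: abelian_group S by (rule skew_abelian_group)
  show ?thesis
    using assms
  proof (induction I rule: finite_induct)
    case (insert i I)
    then have "finsum S f (insert i I) = f i \<oplus>\<^bsub>S\<^esub> finsum S f I" by (intro S.finsum_insert) auto
    with insert show ?case by (simp add: skew_add Pi_iff)
  qed (simp add: skew_zero)
qed

lemma single_expansion:
  assumes f: "f \<in> carrier S"
  shows "f = finsum S (\<lambda>g. single (f g) g) (arr G)"
proof
  fix k
  have cl: "(\<lambda>g. single (f g) g) \<in> arr G \<rightarrow> carrier S"
    using f by (auto intro: single_closed skew_D)
  have "finsum S (\<lambda>g. single (f g) g) (arr G) k = finsum A (\<lambda>g. if k = g then f g else \<zero>) (arr G)"
    using skew_finsum_apply[OF finite_arr cl, of k] by (simp add: single_def)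
  also have "\<dots> = f k"
  proof (cases "k \<in> arr G")
    case True
    then show ?thesis using f by (subst finsum_delta[OF finite_arr True]) auto
  next
    case False
    then have "finsum A (\<lambda>g. if k = g then f g else \<zero>) (arr G) = finsum A (\<lambda>g. \<zero>) (arr G)"
      by (intro finsum_cong') auto
    then show ?thesis using False f by (simp add: skew_outside)
  qed
  finally show "f k = finsum S (\<lambda>g. single (f g) g) (arr G) k" by simp
qed

text \<open>Every element is a finite sum of homogeneous terms. Associativity and commutation with a
  tensor are additive, so they need only be checked on such terms.\<close>

lemma skew_induct [consumes 1, case_names zero single add]:
  assumes f: "f \<in> carrier S" and zero: "P \<zero>\<^bsub>S\<^esub>"
    and single: "\<And>g a. \<lbrakk>g \<in> arr G; a \<in> D g\<rbrakk> \<Longrightarrow> P (single a g)"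
    and add: "\<And>f f'. \<lbrakk>f \<in> carrier S; f' \<in> carrier S; P f; P f'\<rbrakk> \<Longrightarrow> P (f \<oplus>\<^bsub>S\<^esub> f')"
  shows "P f"
proof -
  interpret S: abelian_group S by (rule skew_abelian_group)
  have cl: "single (f g) g \<in> carrier S" if "g \<in> arr G" for g
    using f that by (auto intro: single_closed skew_D)
  have "P (finsum S (\<lambda>g. single (f g) g) I)" if "finite I" "I \<subseteq> arr G" for I
    using that
  proof (induction I rule: finite_induct)
    case (insert g I)
    then have "finsum S (\<lambda>g. single (f g) g) (insert g I)
        = single (f g) g \<oplus>\<^bsub>S\<^esub> finsum S (\<lambda>g. single (f g) g) I"
      using cl by (intro S.finsum_insert) auto
    moreover have "finsum S (\<lambda>g. single (f g) g) I \<in> carrier S"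
      using cl insert by (intro S.finsum_closed) auto
    ultimately show ?case using insert cl f by (auto intro!: add single skew_D)
  qed (simp add: zero)
  from this[OF finite_arr subset_refl] show ?thesis
    using single_expansion[OF f] by simp
qed

lemma single_mult:
  assumes g: "g \<in> arr G" and h: "h \<in> arr G" and a: "a \<in> D g" and b: "b \<in> D h"
  shows "single a g \<otimes>\<^bsub>S\<^esub> single b h =
    (if src G g = tgt G h then single (a \<otimes> act g b) (g \<bullet>\<^bsub>G\<^esub> h) else \<zero>\<^bsub>S\<^esub>)"
proof
  fix k
  let ?F = "\<lambda>p. if (g, h) = p then a \<otimes> act g b else \<zero>"
  have ab: "a \<in> carrier A" "b \<in> carrier A" using assms D_carrier by auto
  have "(single a g \<otimes>\<^bsub>S\<^esub> single b h) k = finsum A ?F (factorizations k)"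
    unfolding skew_mult[OF single_closed[OF g a] single_closed[OF h b]]
  proof (rule finsum_cong')
    fix p assume "p \<in> factorizations k"
    then obtain g' h' where p: "p = (g', h')" "g' \<in> arr G" "h' \<in> arr G"
      by (rule factorizationsE)
    show "(case p of (g', h') \<Rightarrow> single a g g' \<otimes> act g' (single b h h')) = ?F p"
      using p ab by (cases "g' = g"; cases "h' = h") (auto simp: single_def)
  qed (use g ab in \<open>auto simp: m_closed\<close>)
  also have "\<dots> = (if (g, h) \<in> factorizations k then a \<otimes> act g b else \<zero>)"
  proof (cases "(g, h) \<in> factorizations k")
    case True
    then show ?thesis
      using ab g by (subst finsum_delta[OF _ True]) (auto simp: m_closed)
  next
    case False
    then have "finsum A ?F (factorizations k) = finsum A (\<lambda>p. \<zero>) (factorizations k)"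
      by (intro finsum_cong') auto
    then show ?thesis using False by simp
  qed
  finally show "(single a g \<otimes>\<^bsub>S\<^esub> single b h) k =
      (if src G g = tgt G h then single (a \<otimes> act g b) (g \<bullet>\<^bsub>G\<^esub> h) else \<zero>\<^bsub>S\<^esub>) k"
    using g h by (auto simp: factorizations_def single_def skew_zero)
qed

lemma single_assoc:
  assumes g: "g \<in> arr G" "a \<in> D g" and h: "h \<in> arr G" "b \<in> D h" and k: "k \<in> arr G" "c \<in> D k"
  shows "single a g \<otimes>\<^bsub>S\<^esub> single b h \<otimes>\<^bsub>S\<^esub> single c k = single a g \<otimes>\<^bsub>S\<^esub> (single b h \<otimes>\<^bsub>S\<^esub> single c k)"
proof (cases "src G g = tgt G h \<and> src G h = tgt G k")
  case True
  have ab: "a \<in> carrier A" "b \<in> carrier A" "c \<in> carrier A" using assms D_carrier by auto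
  have gh: "g \<bullet>\<^bsub>G\<^esub> h \<in> arr G" "a \<otimes> act g b \<in> D (g \<bullet>\<^bsub>G\<^esub> h)"
    and hk: "h \<bullet>\<^bsub>G\<^esub> k \<in> arr G" "b \<otimes> act h c \<in> D (h \<bullet>\<^bsub>G\<^esub> k)"
    using True assms ab by (auto intro!: comp_closed D_mult_left act_D_comp)
  \<comment> \<open>The error factor 1_g of the composition law is absorbed by
    \<open>act g b\<close>, which lies in A_g; this is why partiality does not spoil
    associativity.\<close>
  have "act g b \<otimes> act g (act h c) = act g b \<otimes> e g \<otimes> act (g \<bullet>\<^bsub>G\<^esub> h) c"
    using True g h ab gh by (simp only: act_act m_assoc act_carrier e_closed)
  then have "a \<otimes> act g b \<otimes> act (g \<bullet>\<^bsub>G\<^esub> h) c = a \<otimes> act g (b \<otimes> act h c)"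
    using g h ab gh by (simp add: act_mult m_assoc)
  then show ?thesis
    using True g h k gh hk by (simp add: single_mult src_comp tgt_comp comp_assoc)
next
  case False
  then show ?thesis
    using assms by (auto simp: single_mult single_closed comp_closed D_mult_left act_D_comp D_carrier
        src_comp tgt_comp skew_l_zero skew_r_zero)
qed

text \<open>Both sides are additive in each factor, so nested inductions over the third, second and
  first factor reduce the claim to homogeneous elements.\<close>

lemma skew_assoc:
  assumes f: "f \<in> carrier S" and f': "f' \<in> carrier S" and f'': "f'' \<in> carrier S"
  shows "f \<otimes>\<^bsub>S\<^esub> f' \<otimes>\<^bsub>S\<^esub> f'' = f \<otimes>\<^bsub>S\<^esub> (f' \<otimes>\<^bsub>S\<^esub> f'')"
proof -
  note [simp] = skew_l_zero skew_r_zero skew_mult_closed skew_add_closed skew_l_distr skew_r_distr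
    single_closed
  have 1: "single a g \<otimes>\<^bsub>S\<^esub> single b h \<otimes>\<^bsub>S\<^esub> f'' = single a g \<otimes>\<^bsub>S\<^esub> (single b h \<otimes>\<^bsub>S\<^esub> f'')"
    if "g \<in> arr G" "a \<in> D g" "h \<in> arr G" "b \<in> D h" for g a h b
    using f'' by (induction rule: skew_induct) (use that in \<open>simp_all add: single_assoc\<close>)
  have 2: "single a g \<otimes>\<^bsub>S\<^esub> f' \<otimes>\<^bsub>S\<^esub> f'' = single a g \<otimes>\<^bsub>S\<^esub> (f' \<otimes>\<^bsub>S\<^esub> f'')"
    if "g \<in> arr G" "a \<in> D g" for g a
    using f' by (induction rule: skew_induct) (use that f'' in \<open>simp_all add: 1\<close>)
  show ?thesis
    using f by (induction rule: skew_induct) (use f' f'' in \<open>simp_all add: 2\<close>)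
qed

section \<open>The base ring inside the skew ring, and its identity\<close>

lemma embed_closed:
  assumes "r \<in> carrier A"
  shows "skew_embed G A D r \<in> carrier S"
  using assms obj_arr by (auto simp: skew_carrier_iff skew_embed_def D_e D_zero)

lemma embed_mult:
  assumes r: "r \<in> carrier A" and f: "f \<in> carrier S"
  shows "skew_embed G A D r \<otimes>\<^bsub>S\<^esub> f = (\<lambda>k. r \<otimes> f k)"
proof
  fix k
  show "(skew_embed G A D r \<otimes>\<^bsub>S\<^esub> f) k = r \<otimes> f k"
  proof (cases "k \<in> arr G")
    case False
    then show ?thesis
      using f r skew_outside[OF skew_mult_closed[OF embed_closed[OF r] f]] by (simp add: skew_outside)
  next
    case k: True
    let ?p = "(tgt G k, k)"
    have t: "tgt G k \<in> objs G" "tgt G k \<in> arr G" using k tgt_obj obj_arr by auto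
    have fk: "f k \<otimes> e (tgt G k) = f k"
      using skew_D[OF f k] D_subset_tgt[OF k] D_iff[OF t(2)] by blast
    have mem: "?p \<in> factorizations k"
      using k t by (auto simp: factorizations_def)
    have zero: "(case p of (y, h) \<Rightarrow> skew_embed G A D r y \<otimes> act y (f h)) = \<zero>"
      if p: "p \<in> factorizations k" "p \<noteq> ?p" for p
    proof -
      obtain y h where yh: "p = (y, h)" "y \<in> arr G" "h \<in> arr G" "src G y = tgt G h" "y \<bullet>\<^bsub>G\<^esub> h = k"
        using p(1) by (rule factorizationsE)
      then have "y \<notin> objs G" using p(2) by auto
      then show ?thesis using yh f by (simp add: skew_embed_def)
    qed
    have "skew_embed G A D r (tgt G k) \<otimes> act (tgt G k) (f k) = r \<otimes> f k"
      using r f t fk e_comm[OF t(2), of "f k"] by (simp add: skew_embed_def m_assoc)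
    then show ?thesis
      unfolding skew_mult[OF embed_closed[OF r] f]
      using finsum_delta[OF _ mem _ zero] r f by (simp add: m_closed)
  qed
qed

lemma mult_embed:
  assumes r: "r \<in> carrier A" and f: "f \<in> carrier S"
  shows "f \<otimes>\<^bsub>S\<^esub> skew_embed G A D r = (\<lambda>k. if k \<in> arr G then f k \<otimes> act k r else \<zero>)"
proof
  fix k
  show "(f \<otimes>\<^bsub>S\<^esub> skew_embed G A D r) k = (if k \<in> arr G then f k \<otimes> act k r else \<zero>)"
  proof (cases "k \<in> arr G")
    case False
    then show ?thesis
      using skew_outside[OF skew_mult_closed[OF f embed_closed[OF r]]] by simp
  next
    case k: True
    let ?p = "(k, src G k)"
    have s: "src G k \<in> objs G" "src G k \<in> arr G" using k src_obj obj_arr by auto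
    have mem: "?p \<in> factorizations k"
      using k s by (auto simp: factorizations_def)
    have zero: "(case p of (h, y) \<Rightarrow> f h \<otimes> act h (skew_embed G A D r y)) = \<zero>"
      if p: "p \<in> factorizations k" "p \<noteq> ?p" for p
    proof -
      obtain h y where hy: "p = (h, y)" "h \<in> arr G" "y \<in> arr G" "src G h = tgt G y" "h \<bullet>\<^bsub>G\<^esub> y = k"
        using p(1) by (rule factorizationsE)
      then have "y \<notin> objs G" using p(2) by auto
      then show ?thesis using hy f by (simp add: skew_embed_def)
    qed
    have "act k (skew_embed G A D r (src G k)) = act k r"
      using act_src[OF k r] s by (simp add: skew_embed_def)
    then show ?thesis
      unfolding skew_mult[OF f embed_closed[OF r]]
      using finsum_delta[OF _ mem _ zero] r f k by (simp add: m_closed)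
  qed
qed

text \<open>The product lies in both A_y and A_z, so it has one expansion concentrated at y and
  another at z. Uniqueness of the decomposition forces it to be zero.\<close>

lemma e_orthogonal:
  assumes y: "y \<in> objs G" and z: "z \<in> objs G" and "y \<noteq> z"
  shows "e y \<otimes> e z = \<zero>"
proof -
  let ?u = "e y \<otimes> e z"
  have yz: "y \<in> arr G" "z \<in> arr G" using y z obj_arr by auto
  have u: "?u \<in> D y" "?u \<in> D z" "?u \<in> carrier A"
    using yz e_e_D by (auto simp: m_closed)
  \<comment> \<open>\<open>f w\<close> places the whole product at the object \<open>w\<close>; it
    is restricted to the objects because uniqueness holds among extensional families.\<close>
  define f where "f w = (\<lambda>v\<in>objs G. if v = w then ?u else \<zero>)" for w
  have f: "f w \<in> (\<Pi>\<^sub>E i\<in>objs G. D i)" "finsum A (f w) (objs G) = ?u" if "w \<in> {y, z}" for w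
  proof -
    show "f w \<in> (\<Pi>\<^sub>E i\<in>objs G. D i)" using that u by (auto simp: f_def D_zero obj_arr)
    have "finsum A (f w) (objs G) = finsum A (\<lambda>v. if w = v then ?u else \<zero>) (objs G)"
      using u by (intro finsum_cong') (auto simp: f_def)
    also have "\<dots> = ?u"
      using that y z u by (intro add.finprod_singleton) auto
    finally show "finsum A (f w) (objs G) = ?u" .
  qed
  have "\<exists>!f. f \<in> (\<Pi>\<^sub>E i\<in>objs G. D i) \<and> ?u = finsum A f (objs G)"
    using direct_sum u(3) by (simp add: is_direct_sum_def)
  then have "f y = f z" using f[of y] f[of z] by (metis insertCI)
  then have "f y y = f z y" by simp
  then show ?thesis using y \<open>y \<noteq> z\<close> by (simp add: f_def)
qed

text \<open>The field \<open>one\<close> of A is unconstrained, so the identity has to be built from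
  the object idempotents; its embedding is the identity of the skew ring.\<close>

definition unit :: 'a where
  "unit = finsum A e (objs G)"

lemma unit_closed [simp]: "unit \<in> carrier A"
  unfolding unit_def by (intro finsum_closed) (auto simp: obj_arr)

lemma unit_e:
  assumes y: "y \<in> objs G"
  shows "unit \<otimes> e y = e y"
proof -
  have "unit \<otimes> e y = finsum A (\<lambda>z. e z \<otimes> e y) (objs G)"
    unfolding unit_def using y by (intro finsum_ldistr) (auto simp: obj_arr)
  also have "\<dots> = finsum A (\<lambda>z. if y = z then e z else \<zero>) (objs G)"
    using y by (intro finsum_cong') (auto simp: obj_arr e_orthogonal)
  also have "\<dots> = e y" using y by (intro add.finprod_singleton) (auto simp: obj_arr)
  finally show ?thesis .
qed

lemma skew_one: "\<one>\<^bsub>S\<^esub> = skew_embed G A D unit"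
  by (auto simp: skew_ring_def skew_embed_def unit_e)

lemma skew_is_ring: "ring S"
proof -
  have D: "unit \<otimes> a = a" if "g \<in> arr G" "a \<in> D g" for g a
  proof -
    have "a \<in> D (tgt G g)" using that D_subset_tgt by blast
    then have "e (tgt G g) \<otimes> a = a" "a \<in> carrier A"
      using e_comm[of "tgt G g" a] that obj_arr[OF tgt_obj[of g]] by (auto simp: D_iff)
    then show ?thesis
      using that unit_e[OF tgt_obj[of g]] obj_arr[OF tgt_obj[of g]] by (metis m_assoc e_closed unit_closed)
  qed
  have act_unit': "act g unit = e g" if "g \<in> arr G" for g
    using act_src[OF that unit_closed] unit_e[OF src_obj[OF that]] act_src_unit[OF that] by simp
  have l: "\<one>\<^bsub>S\<^esub> \<otimes>\<^bsub>S\<^esub> f = f" if f: "f \<in> carrier S" for f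
  proof
    fix k
    show "(\<one>\<^bsub>S\<^esub> \<otimes>\<^bsub>S\<^esub> f) k = f k"
      unfolding skew_one embed_mult[OF unit_closed f]
      by (cases "k \<in> arr G") (use f D[of k "f k"] in \<open>auto simp: skew_D skew_outside\<close>)
  qed
  have r: "f \<otimes>\<^bsub>S\<^esub> \<one>\<^bsub>S\<^esub> = f" if f: "f \<in> carrier S" for f
  proof
    fix k
    show "(f \<otimes>\<^bsub>S\<^esub> \<one>\<^bsub>S\<^esub>) k = f k"
      unfolding skew_one mult_embed[OF unit_closed f]
      using f skew_D[OF f, of k] by (auto simp: D_iff act_unit' skew_outside)
  qed
  have "monoid S"
    by (rule monoidI) (auto simp: skew_mult_closed skew_assoc l r, simp add: skew_one embed_closed)
  then show ?thesis
    by (intro ringI skew_abelian_group) (auto simp: skew_l_distr skew_r_distr)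
qed

lemma embed_subring: "subring (skew_embed G A D ` carrier A) S"
proof -
  interpret S: ring S by (rule skew_is_ring)
  let ?i = "skew_embed G A D"
  have add: "?i a \<oplus>\<^bsub>S\<^esub> ?i b = ?i (a \<oplus> b)" if "a \<in> carrier A" "b \<in> carrier A" for a b
    using that by (auto simp: fun_eq_iff skew_add skew_embed_def l_distr obj_arr)
  have mult: "?i a \<otimes>\<^bsub>S\<^esub> ?i b = ?i (a \<otimes> b)" if "a \<in> carrier A" "b \<in> carrier A" for a b
    unfolding embed_mult[OF that(1) embed_closed[OF that(2)]] using that
    by (auto simp: fun_eq_iff skew_embed_def m_assoc obj_arr)
  have inv: "\<ominus>\<^bsub>S\<^esub> ?i a = ?i (\<ominus> a)" if "a \<in> carrier A" for a
  proof -
    have "?i (\<ominus> a) \<oplus>\<^bsub>S\<^esub> ?i a = \<zero>\<^bsub>S\<^esub>"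
      using that by (simp add: add l_neg) (simp add: fun_eq_iff skew_embed_def skew_zero_apply obj_arr)
    then show ?thesis using that by (intro S.minus_equality) (auto simp: embed_closed)
  qed
  show ?thesis
    by (rule S.subringI) (auto simp: embed_closed add mult inv m_closed skew_one)
qed

end

section \<open>The trace criterion\<close>

context unital_action
begin

text \<open>The only factorization of k that begins with g is g (g^-1 k), so a homogeneous left
  factor merely shifts coefficients. \<open>mult_single_apply\<close> is the same for a right
  factor.\<close>

lemma single_mult_apply:
  assumes g: "g \<in> arr G" and a: "a \<in> D g" and f: "f \<in> carrier S" and k: "k \<in> arr G" "tgt G k = tgt G g"
  shows "(single a g \<otimes>\<^bsub>S\<^esub> f) k = a \<otimes> act g (f (ginv G g \<bullet>\<^bsub>G\<^esub> k))"
proof -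
  let ?p = "(g, ginv G g \<bullet>\<^bsub>G\<^esub> k)"
  have ac: "a \<in> carrier A" using D_carrier g a by blast
  have "?p \<in> factorizations k"
    using g k by (auto simp: factorizations_def comp_closed tgt_comp)
  moreover have "(case p of (g', h') \<Rightarrow> single a g g' \<otimes> act g' (f h')) = \<zero>"
    if "p \<in> factorizations k" "p \<noteq> ?p" for p
  proof -
    obtain g' h' where p: "p = (g', h')" "g' \<in> arr G" "h' \<in> arr G" "src G g' = tgt G h'" "g' \<bullet>\<^bsub>G\<^esub> h' = k"
      using \<open>p \<in> factorizations k\<close> by (rule factorizationsE)
    then have "g' \<noteq> g" using that(2) by auto
    then show ?thesis using p f by (simp add: single_def)
  qed
  ultimately show ?thesis
    unfolding skew_mult[OF single_closed[OF g a] f] using g ac f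
    by (subst finsum_delta[of _ ?p]) (auto simp: single_def m_closed)
qed

lemma mult_single_apply:
  assumes h: "h \<in> arr G" and b: "b \<in> D h" and f: "f \<in> carrier S" and k: "k \<in> arr G" "src G k = src G h"
  shows "(f \<otimes>\<^bsub>S\<^esub> single b h) k = f (k \<bullet>\<^bsub>G\<^esub> ginv G h) \<otimes> act (k \<bullet>\<^bsub>G\<^esub> ginv G h) b"
proof -
  let ?p = "(k \<bullet>\<^bsub>G\<^esub> ginv G h, h)"
  have bc: "b \<in> carrier A" using D_carrier h b by blast
  have kh: "k \<bullet>\<^bsub>G\<^esub> ginv G h \<in> arr G" using h k by (simp add: comp_closed)
  have "?p \<in> factorizations k"
    using h k kh by (auto simp: factorizations_def src_comp)
  moreover have "(case p of (g', h') \<Rightarrow> f g' \<otimes> act g' (single b h h')) = \<zero>"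
    if "p \<in> factorizations k" "p \<noteq> ?p" for p
  proof -
    obtain g' h' where p: "p = (g', h')" "g' \<in> arr G" "h' \<in> arr G" "src G g' = tgt G h'" "g' \<bullet>\<^bsub>G\<^esub> h' = k"
      using \<open>p \<in> factorizations k\<close> by (rule factorizationsE)
    then have "h' \<noteq> h" using that(2) by auto
    then show ?thesis using p f by (simp add: single_def)
  qed
  ultimately show ?thesis
    unfolding skew_mult[OF f single_closed[OF h b]] using kh bc f
    by (subst finsum_delta[of _ ?p]) (auto simp: single_def m_closed)
qed

text \<open>With a single object this is a central element of partial trace 1, as in the classical
  criterion for skew group rings.\<close>

definition trace_family :: "('g \<Rightarrow> 'a) \<Rightarrow> bool" where
  "trace_family c \<longleftrightarrow> (\<forall>y\<in>objs G. c y \<in> D y \<and> c y \<in> rng_center A) \<and>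
     (\<forall>y\<in>objs G. finsum A (\<lambda>g. act g (c (src G g))) {g \<in> arr G. tgt G g = y} = e y)"

sublocale pair: ring_pair S "skew_embed G A D ` carrier A"
  by (intro ring_pair.intro skew_is_ring ring_pair_axioms.intro) (auto simp: embed_closed)

lemma skew_add_apply: "(\<lambda>f. f k) \<in> hom (add_monoid S) (add_monoid A)"
  by (auto simp: hom_def skew_add)

lemma act_hom: "g \<in> arr G \<Longrightarrow> act g \<in> hom (add_monoid A) (add_monoid A)"
  by (auto simp: hom_def act_add)

lemma factorizations_obj:
  assumes y: "y \<in> objs G"
  shows "factorizations y = (\<lambda>g. (g, ginv G g)) ` {g \<in> arr G. tgt G g = y}"
proof -
  have "h = ginv G g \<and> tgt G g = y" if "g \<in> arr G" "h \<in> arr G" "src G g = tgt G h" "g \<bullet>\<^bsub>G\<^esub> h = y" for g h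
    using that y tgt_comp[of g h] ginv_eqI[of g h] by auto
  then show ?thesis by (auto simp: factorizations_def)
qed

text \<open>A scalar r moves across because (s r)_g = s_g act g r, and s_g act g r act g (t_h) = s_g
  act g (r t_h), where r t_h is the coefficient of r t at h.\<close>

lemma balanced_component:
  assumes g: "g \<in> arr G" and h: "h \<in> arr G" and hg: "tgt G h = src G g"
  shows "pair.balanced A (\<lambda>p. fst p g \<otimes> act g (snd p h))"
proof -
  have mid: "s g \<otimes> act g r \<otimes> act g (t h) = s g \<otimes> act g (r \<otimes> t h)"
    if "s \<in> carrier S" "t \<in> carrier S" "r \<in> carrier A" for s t r
    using that g by (simp add: act_mult m_assoc)
  show ?thesis
    unfolding pair.balanced_def
    using g h by (auto simp: skew_add l_distr r_distr act_add embed_mult mult_embed mid intro!: m_closed)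
qed

lemma separable_imp_trace_family:
  assumes "skew_separable G A D \<alpha>"
  shows "\<exists>c. trace_family c"
proof -
  obtain t where t: "Poly_Mapping.keys t \<subseteq> pair.pairs"
    and comm: "\<And>s. s \<in> carrier S \<Longrightarrow>
      pair.lmult_frag s t - pair.rmult_frag s t \<in> tensor_null S (skew_embed G A D ` carrier A)"
    and one: "frag_sum S (\<lambda>p. fst p \<otimes>\<^bsub>S\<^esub> snd p) t = \<one>\<^bsub>S\<^esub>"
    using assms unfolding skew_separable_def pair.separable_extension_iff[OF embed_subring] by auto
  define \<phi> where "\<phi> g h p = fst p g \<otimes> act g (snd p h)" for g h and p :: "('g \<Rightarrow> 'a) \<times> ('g \<Rightarrow> 'a)"
  have \<phi>_closed: "\<phi> g h \<in> pair.pairs \<rightarrow> carrier A" if "g \<in> arr G" for g h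
    using that by (auto simp: \<phi>_def intro!: m_closed)
  have bal: "pair.balanced A (\<phi> g h)" if "g \<in> arr G" "h \<in> arr G" "tgt G h = src G g" for g h
    using balanced_component[OF that] unfolding \<phi>_def .
  have \<phi>_obj: "\<phi> y y p = fst p y \<otimes> snd p y" if "y \<in> objs G" "p \<in> pair.pairs" for y p
  proof -
    have "snd p y \<otimes> e y = snd p y" using that skew_D[of "snd p" y] D_iff obj_arr by auto
    then show ?thesis using that by (auto simp: \<phi>_def)
  qed
  define c where "c y = frag_sum A (\<phi> y y) t" for y
  have c_closed: "c y \<in> carrier A" if "y \<in> objs G" for y
    unfolding c_def using frag_sum_closed[OF t \<phi>_closed] that obj_arr by auto
  have c_D: "c y \<in> D y" if y: "y \<in> objs G" for y
  proof -
    have ya: "y \<in> arr G" using y obj_arr by blast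
    have "(\<lambda>a. a \<otimes> e y) \<in> hom (add_monoid A) (add_monoid A)"
      using ya by (auto simp: hom_def l_distr m_closed)
    from hom_frag_sum[OF \<phi>_closed[OF ya] this abelian_group_axioms t]
    have "c y \<otimes> e y = frag_sum A (\<lambda>p. \<phi> y y p \<otimes> e y) t" by (simp add: c_def)
    also have "\<dots> = c y"
      unfolding c_def
    proof (rule frag_sum_cong[OF _ \<phi>_closed[OF ya] t])
      fix p assume p: "p \<in> pair.pairs"
      then have "\<phi> y y p \<in> D y"
        using ya y by (auto simp: \<phi>_obj D_mult_left skew_D)
      then show "\<phi> y y p \<otimes> e y = \<phi> y y p" using ya D_iff by blast
    qed
    finally show ?thesis using c_closed[OF y] D_iff[OF ya] by simp
  qed
  \<comment> \<open>Commutation of the tensor with the embedded r, read at the component (y, y),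
    where the left action multiplies by r on the left and the right action by r on the
    right.\<close>
  have c_center: "c y \<in> rng_center A" if y: "y \<in> objs G" for y
    unfolding rng_center_def
  proof (intro CollectI conjI ballI c_closed y)
    fix r assume r: "r \<in> carrier A"
    have ya: "y \<in> arr G" using y obj_arr by blast
    have h: "(\<lambda>a. a \<otimes> r) \<in> hom (add_monoid A) (add_monoid A)"
        "(\<lambda>a. r \<otimes> a) \<in> hom (add_monoid A) (add_monoid A)"
      using r by (auto simp: hom_def l_distr r_distr m_closed)
    let ?r = "skew_embed G A D r"
    have rS: "?r \<in> carrier S" by (rule embed_closed[OF r])
    have 1: "\<phi> y y (fst p, snd p \<otimes>\<^bsub>S\<^esub> ?r) = \<phi> y y p \<otimes> r" if p: "p \<in> pair.pairs" for p
    proof -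
      have pc: "fst p \<in> carrier S" "snd p \<in> carrier S" using p by auto
      then have "snd p y \<otimes> r \<otimes> e y = snd p y \<otimes> r"
        using D_mult_right[OF ya r skew_D[OF pc(2) ya]] D_iff[OF ya] by blast
      moreover have "(snd p \<otimes>\<^bsub>S\<^esub> ?r) y = snd p y \<otimes> r \<otimes> e y"
        using pc r y ya by (simp add: mult_embed m_assoc)
      moreover have "\<phi> y y (fst p, snd p \<otimes>\<^bsub>S\<^esub> ?r) = fst p y \<otimes> (snd p \<otimes>\<^bsub>S\<^esub> ?r) y"
        using pc y by (subst \<phi>_obj) (auto simp: skew_mult_closed rS)
      ultimately show ?thesis
        using pc p r y by (simp add: \<phi>_obj m_assoc)
    qed
    have 2: "\<phi> y y (?r \<otimes>\<^bsub>S\<^esub> fst p, snd p) = r \<otimes> \<phi> y y p" if p: "p \<in> pair.pairs" for p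
    proof -
      have "\<phi> y y (?r \<otimes>\<^bsub>S\<^esub> fst p, snd p) = (?r \<otimes>\<^bsub>S\<^esub> fst p) y \<otimes> snd p y"
        using p y by (subst \<phi>_obj) (auto simp: skew_mult_closed rS)
      then show ?thesis using p r y by (auto simp: \<phi>_obj embed_mult m_assoc)
    qed
    have "c y \<otimes> r = frag_sum A (\<lambda>p. \<phi> y y p \<otimes> r) t"
      unfolding c_def by (rule hom_frag_sum[OF \<phi>_closed[OF ya] h(1) abelian_group_axioms t])
    also have "\<dots> = frag_sum A (\<lambda>p. \<phi> y y (fst p, snd p \<otimes>\<^bsub>S\<^esub> ?r)) t"
      using 1 \<phi>_closed[OF ya, of y] skew_mult_closed rS r
      by (intro frag_sum_cong[OF _ _ t]) (auto simp: Pi_iff m_closed)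
    also have "\<dots> = frag_sum A (\<lambda>p. \<phi> y y (?r \<otimes>\<^bsub>S\<^esub> fst p, snd p)) t"
      using pair.frag_sum_balanced_commute[OF abelian_group_axioms bal[of y y] t rS comm[OF rS]] y ya by simp
    also have "\<dots> = frag_sum A (\<lambda>p. r \<otimes> \<phi> y y p) t"
      using 2 \<phi>_closed[OF ya, of y] r m_closed
      by (intro frag_sum_cong[OF _ _ t]) (auto simp: Pi_iff)
    also have "\<dots> = r \<otimes> c y"
      unfolding c_def by (rule hom_frag_sum[OF \<phi>_closed[OF ya] h(2) abelian_group_axioms t, symmetric])
    finally show "c y \<otimes> r = r \<otimes> c y" .
  qed
  \<comment> \<open>For u = 1_g \<delta>_g, (u s)_g = act g (s_{s(g)}), whereas (t u)_{s(g)} =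
    t_{g^-1}, because \<open>act\<close> of g^-1 sends 1_g to 1_{g^-1}, which fixes
    t_{g^-1}.\<close>
  have shift: "frag_sum A (\<phi> g (ginv G g)) t = act g (c (src G g))" if g: "g \<in> arr G" for g
  proof -
    let ?y = "src G g" and ?u = "single (e g) g"
    have y: "?y \<in> objs G" "?y \<in> arr G" using g src_obj obj_arr by auto
    have u: "?u \<in> carrier S" using g e_D by (intro single_closed) auto
    have 1: "\<phi> g ?y (?u \<otimes>\<^bsub>S\<^esub> fst p, snd p) = act g (\<phi> ?y ?y p)" if p: "p \<in> pair.pairs" for p
    proof -
      have "(?u \<otimes>\<^bsub>S\<^esub> fst p) g = act g (fst p ?y)"
        using g p y single_mult_apply[OF g e_D[OF g], of "fst p" g] by auto
      then show ?thesis using g p y by (auto simp: \<phi>_obj act_mult) (simp add: \<phi>_def)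
    qed
    have 2: "\<phi> g ?y (fst p, snd p \<otimes>\<^bsub>S\<^esub> ?u) = \<phi> g (ginv G g) p" if p: "p \<in> pair.pairs" for p
    proof -
      have ps: "snd p \<in> carrier S" using p by auto
      have "(snd p \<otimes>\<^bsub>S\<^esub> ?u) ?y = snd p (ginv G g) \<otimes> act (ginv G g) (e g)"
        using g y mult_single_apply[OF g e_D[OF g] ps, of ?y] by simp
      also have "\<dots> = snd p (ginv G g)"
        using g act_unit[of "ginv G g"] skew_D[OF ps, of "ginv G g"] D_iff[of "ginv G g"] by simp
      finally show ?thesis by (simp add: \<phi>_def)
    qed
    have "act g (c ?y) = frag_sum A (\<lambda>p. act g (\<phi> ?y ?y p)) t"
      unfolding c_def by (rule hom_frag_sum[OF \<phi>_closed[OF y(2)] act_hom[OF g] abelian_group_axioms t])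
    also have "\<dots> = frag_sum A (\<lambda>p. \<phi> g ?y (?u \<otimes>\<^bsub>S\<^esub> fst p, snd p)) t"
      using 1 \<phi>_closed[OF g, of ?y] \<phi>_closed[OF y(2), of ?y] g skew_mult_closed u
      by (intro frag_sum_cong[OF _ _ t]) (auto simp: Pi_iff)
    also have "\<dots> = frag_sum A (\<lambda>p. \<phi> g ?y (fst p, snd p \<otimes>\<^bsub>S\<^esub> ?u)) t"
      using pair.frag_sum_balanced_commute[OF abelian_group_axioms bal[of g ?y] t u comm[OF u]] g y by simp
    also have "\<dots> = frag_sum A (\<phi> g (ginv G g)) t"
      using 2 by (intro frag_sum_cong[OF _ \<phi>_closed[OF g] t])
    finally show ?thesis by simp
  qed
  \<comment> \<open>The factorizations of an object y are exactly the pairs (g, g^-1) with t(g) = y,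
    so by \<open>shift\<close> the trace is the coefficient at y of the image under
    multiplication.\<close>
  have trace: "finsum A (\<lambda>g. act g (c (src G g))) {g \<in> arr G. tgt G g = y} = e y" if y: "y \<in> objs G" for y
  proof -
    let ?J = "{g \<in> arr G. tgt G g = y}"
    have fin: "finite ?J" using finite_arr by simp
    have "finsum A (\<lambda>g. act g (c (src G g))) ?J = finsum A (\<lambda>g. frag_sum A (\<phi> g (ginv G g)) t) ?J"
      using frag_sum_closed[OF t \<phi>_closed] by (intro finsum_cong') (auto simp: shift)
    also have "\<dots> = frag_sum A (\<lambda>p. finsum A (\<lambda>g. \<phi> g (ginv G g) p) ?J) t"
      using \<phi>_closed by (intro frag_sum_finsum[OF fin _ t]) auto
    also have "\<dots> = frag_sum A (\<lambda>p. (fst p \<otimes>\<^bsub>S\<^esub> snd p) y) t"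
    proof (rule frag_sum_cong[OF _ _ t])
      fix p assume p: "p \<in> pair.pairs"
      have "(fst p \<otimes>\<^bsub>S\<^esub> snd p) y = finsum A (\<lambda>(g, h). \<phi> g h p) (factorizations y)"
        using p by (auto simp: skew_mult \<phi>_def)
      also have "\<dots> = finsum A (\<lambda>g. \<phi> g (ginv G g) p) ?J"
        unfolding factorizations_obj[OF y]
        using p \<phi>_closed by (subst finsum_reindex) (auto simp: inj_on_def)
      finally show "finsum A (\<lambda>g. \<phi> g (ginv G g) p) ?J = (fst p \<otimes>\<^bsub>S\<^esub> snd p) y" by simp
    qed (auto simp: skew_mult_closed)
    also have "\<dots> = frag_sum S (\<lambda>p. fst p \<otimes>\<^bsub>S\<^esub> snd p) t y"
      by (rule abelian_group.hom_frag_sum[OF skew_abelian_group _ skew_add_apply abelian_group_axioms t, symmetric])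
        (auto simp: skew_mult_closed)
    also have "\<dots> = e y" using one y by (simp add: skew_ring_def)
    finally show ?thesis .
  qed
  from c_D c_center trace show ?thesis unfolding trace_family_def by blast
qed

text \<open>As \<open>act g c\<close> lies in A_g, it meets only r 1_g, and r 1_g is
  \<open>act g\<close> of some element of A, with which c commutes.\<close>

lemma act_center:
  assumes g: "g \<in> arr G" and c: "c \<in> rng_center A"
  shows "act g c \<in> rng_center A"
  unfolding rng_center_def
proof (intro CollectI conjI ballI)
  have cc: "c \<in> carrier A" "\<And>r. r \<in> carrier A \<Longrightarrow> c \<otimes> r = r \<otimes> c" using c by (auto simp: rng_center_def)
  show "act g c \<in> carrier A" using g cc by simp
  fix r assume r: "r \<in> carrier A"
  let ?r = "act (ginv G g) (r \<otimes> e g)"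
  have er: "act g ?r = r \<otimes> e g" using g r act_ginv_right[OF g D_e[OF g r]] by simp
  have rc: "?r \<in> carrier A" using g r m_closed by simp
  have "act g c \<otimes> (r \<otimes> e g) = (r \<otimes> e g) \<otimes> act g c"
    using act_mult[OF g cc(1) rc] act_mult[OF g rc cc(1)] cc(2)[OF rc] er by simp
  then have "act g c \<otimes> r \<otimes> e g = r \<otimes> act g c"
    using g r cc by (simp add: m_assoc)
  moreover have "act g c \<otimes> r \<otimes> e g = act g c \<otimes> r"
    using D_mult_right[OF g r act_closed[OF g cc(1)]] D_iff[OF g] by blast
  ultimately show "act g c \<otimes> r = r \<otimes> act g c" by simp
qed

text \<open>Commutation is additive in s, so s = b \<delta>_h suffices. Left multiplication by h
  maps the arrows with target s(h) bijectively onto those with target t(h), and this pairs the terms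
  of s t with the terms of t s; terms outside these sets vanish.\<close>

lemma trace_family_imp_separable:
  assumes "trace_family c"
  shows "skew_separable G A D \<alpha>"
proof -
  let ?N = "tensor_null S (skew_embed G A D ` carrier A)"
  have c: "c y \<in> D y" "c y \<in> rng_center A" "c y \<in> carrier A" if "y \<in> objs G" for y
    using assms that by (auto simp: trace_family_def rng_center_def)
  have trace: "finsum A (\<lambda>g. act g (c (src G g))) {g \<in> arr G. tgt G g = y} = e y" if "y \<in> objs G" for y
    using assms that by (auto simp: trace_family_def)
  define u where "u g = act g (c (src G g))" for g
  have u: "u g \<in> D g" "u g \<in> carrier A" "\<And>r. r \<in> carrier A \<Longrightarrow> u g \<otimes> r = r \<otimes> u g" if "g \<in> arr G" for g
    using act_center[OF that c(2)[OF src_obj[OF that]]] act_closed[OF that c(3)[OF src_obj[OF that]]]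
    unfolding u_def rng_center_def by auto
  define P where "P g = single (u g) g" for g
  define Q where "Q g = single (e (ginv G g)) (ginv G g)" for g
  have P: "P g \<in> carrier S" and Q: "Q g \<in> carrier S" if "g \<in> arr G" for g
    using that u e_D by (auto simp: P_def Q_def intro!: single_closed)
  define t where "t = (\<Sum>g\<in>arr G. frag_of (P g, Q g))"
  have tk: "Poly_Mapping.keys (frag_of (P g, Q g)) \<subseteq> pair.pairs" if "g \<in> arr G" for g
    using that P Q by (simp add: keys_frag_of)
  have t_keys: "Poly_Mapping.keys t \<subseteq> pair.pairs"
    using sum_closed_free_Abelian_group[of "arr G" "\<lambda>g. frag_of (P g, Q g)" pair.pairs] tk
    by (simp add: t_def)
  have lm: "pair.lmult_frag s t = (\<Sum>g\<in>arr G. frag_of (s \<otimes>\<^bsub>S\<^esub> P g, Q g))" for s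
    unfolding t_def by (simp add: frag_extend_sum[OF finite_arr])
  have rm: "pair.rmult_frag s t = (\<Sum>g\<in>arr G. frag_of (P g, Q g \<otimes>\<^bsub>S\<^esub> s))" for s
    unfolding t_def by (simp add: frag_extend_sum[OF finite_arr])
  have "frag_sum S (\<lambda>p. fst p \<otimes>\<^bsub>S\<^esub> snd p) t = finsum S (\<lambda>g. single (u g) (tgt G g)) (arr G)"
  proof -
    \<comment> \<open>As \<open>act g\<close> sends 1_{g^-1} to 1_g and u_g lies in A_g, each
      product sits at the object t(g); grouping by target produces the traces.\<close>
    have PQ: "P g \<otimes>\<^bsub>S\<^esub> Q g = single (u g) (tgt G g)" if g: "g \<in> arr G" for g
      using g u[OF g] e_D[of "ginv G g"] D_iff[OF g, of "u g"] by (simp add: P_def Q_def single_mult)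
    have "frag_sum S (\<lambda>p. fst p \<otimes>\<^bsub>S\<^esub> snd p) t
        = finsum S (\<lambda>g. frag_sum S (\<lambda>p. fst p \<otimes>\<^bsub>S\<^esub> snd p) (frag_of (P g, Q g))) (arr G)"
      unfolding t_def using tk finite_arr by (intro pair.frag_sum_sum[where B = pair.pairs]) auto
    also have "\<dots> = finsum S (\<lambda>g. single (u g) (tgt G g)) (arr G)"
    proof (rule pair.finsum_cong')
      show "(\<lambda>g. single (u g) (tgt G g)) \<in> arr G \<rightarrow> carrier S"
        using P Q pair.m_closed by (auto simp flip: PQ)
      show "frag_sum S (\<lambda>p. fst p \<otimes>\<^bsub>S\<^esub> snd p) (frag_of (P g, Q g)) = single (u g) (tgt G g)"
        if "g \<in> arr G" for g
        using that P Q by (subst pair.frag_sum_of) (auto simp flip: PQ)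
    qed simp
    finally show ?thesis .
  qed
  also have "\<dots> = \<one>\<^bsub>S\<^esub>"
  proof
    fix k
    have "finsum S (\<lambda>g. single (u g) (tgt G g)) (arr G) k = finsum A (\<lambda>g. single (u g) (tgt G g) k) (arr G)"
    proof (rule skew_finsum_apply[OF finite_arr])
      show "(\<lambda>g. single (u g) (tgt G g)) \<in> arr G \<rightarrow> carrier S"
        using u(1) by (auto intro!: single_closed intro: subsetD[OF D_subset_tgt] simp: tgt_obj obj_arr)
    qed
    also have "\<dots> = finsum A u {g \<in> arr G. tgt G g = k}"
      by (rule add.finprod_mono_neutral_cong_right)
        (use u finite_arr in \<open>auto simp: single_def\<close>)
    also have "\<dots> = \<one>\<^bsub>S\<^esub> k"
    proof (cases "k \<in> objs G")
      case True
      then show ?thesis using trace unfolding u_def by (simp add: skew_ring_def)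
    next
      case False
      then have "{g \<in> arr G. tgt G g = k} = {}" using tgt_obj by auto
      then show ?thesis using False by (simp only: finsum_empty) (simp add: skew_ring_def)
    qed
    finally show "finsum S (\<lambda>g. single (u g) (tgt G g)) (arr G) k = \<one>\<^bsub>S\<^esub> k" .
  qed
  finally have one: "frag_sum S (\<lambda>p. fst p \<otimes>\<^bsub>S\<^esub> snd p) t = \<one>\<^bsub>S\<^esub>" .
  have "pair.lmult_frag s t - pair.rmult_frag s t \<in> ?N" if "s \<in> carrier S" for s
    using that
  proof (induction rule: skew_induct)
    case zero
    show ?case
      unfolding lm rm
      by (intro pair.tensor_null_diff pair.tensor_null_sum)
        (simp_all add: P Q skew_l_zero skew_r_zero pair.tensor_zero_left pair.tensor_zero_right)
  next
    case (add s s')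
    have l: "pair.lmult_frag (s \<oplus>\<^bsub>S\<^esub> s') t - pair.lmult_frag s t - pair.lmult_frag s' t \<in> ?N"
      unfolding lm sum_subtractf[symmetric]
      using add P Q by (intro pair.tensor_null_sum)
        (simp add: skew_l_distr pair.tensor_add_left skew_mult_closed)
    have r: "pair.rmult_frag (s \<oplus>\<^bsub>S\<^esub> s') t - pair.rmult_frag s t - pair.rmult_frag s' t \<in> ?N"
      unfolding rm sum_subtractf[symmetric]
      using add P Q by (intro pair.tensor_null_sum)
        (simp add: skew_r_distr pair.tensor_add_right skew_mult_closed)
    show ?case
      using pair.tensor_null_add[OF pair.tensor_null_diff[OF l r] pair.tensor_null_add[OF add.IH]]
      by (simp add: algebra_simps)
  next
    case (single h b)
    let ?s = "single b h"
    have s: "?s \<in> carrier S" using single by (rule single_closed)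
    have b: "b \<in> carrier A" using single D_carrier by blast
    let ?F = "\<lambda>g. frag_of (?s \<otimes>\<^bsub>S\<^esub> P g, Q g)" and ?H = "\<lambda>k. frag_of (P k, Q k \<otimes>\<^bsub>S\<^esub> ?s)"
    let ?I = "{g \<in> arr G. tgt G g = src G h}" and ?J = "{k \<in> arr G. tgt G k = tgt G h}"
    \<comment> \<open>With k = hg, the two terms differ by one balancing relation: both come from
      P_k and Q_g, with a scalar r on either side of the tensor sign.\<close>
    have I: "?F g - ?H (h \<bullet>\<^bsub>G\<^esub> g) \<in> ?N" if "g \<in> ?I" for g
    proof -
      let ?k = "h \<bullet>\<^bsub>G\<^esub> g"
      \<comment> \<open>Chosen so that \<open>act ?k ?r\<close> is 1_k b: then r appears to the
        right of P_k as b, and to the left of Q_g as the coefficient that b leaves in Q_k s.\<close>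
      let ?r = "act (ginv G ?k) b"
      have g: "g \<in> arr G" "tgt G g = src G h" using that by auto
      then have k: "?k \<in> arr G" "src G ?k = src G g" "tgt G ?k = tgt G h"
        using single comp_closed src_comp tgt_comp by auto
      have kh: "ginv G ?k \<bullet>\<^bsub>G\<^esub> h = ginv G g"
        using g k single comp_src[of "ginv G g"] by (simp add: ginv_of_comp comp_assoc)
      have r: "?r \<in> carrier A" "?r \<in> D (ginv G g)"
        using act_D_comp[of "ginv G ?k" h b] single k kh b by auto
      \<comment> \<open>Equivariance of the family u up to 1_h, which the coefficient b absorbs
        because it lies in A_h.\<close>
      have "act h (u g) = e h \<otimes> u ?k"
        unfolding u_def using act_act[of h g "c (src G g)"] g k single c(3)[OF src_obj[of g]] by simp
      then have "b \<otimes> act h (u g) = b \<otimes> u ?k"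
        using single b k u(2) D_iff[of h b] by (simp flip: m_assoc)
      then have sP: "?s \<otimes>\<^bsub>S\<^esub> P g = single (b \<otimes> u ?k) ?k"
        using single g u(1)[of g] by (simp add: P_def single_mult)
      have "act ?k ?r = e ?k \<otimes> (b \<otimes> e (tgt G ?k))"
        using act_act[of ?k "ginv G ?k" b] k b tgt_obj[of ?k] by simp
      also have "b \<otimes> e (tgt G ?k) = b"
        using single k D_subset_tgt[of h] D_iff[of "tgt G h" b] obj_arr[OF tgt_obj[of h]] by auto
      finally have kr: "act ?k ?r = e ?k \<otimes> b" .
      have sP': "?s \<otimes>\<^bsub>S\<^esub> P g = P ?k \<otimes>\<^bsub>S\<^esub> skew_embed G A D ?r"
      proof
        fix l
        \<comment> \<open>Here the centrality of the trace family is used: u_k inherits it through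
          \<open>act_center\<close>, so b can change sides.\<close>
        have "u ?k \<otimes> (e ?k \<otimes> b) = b \<otimes> u ?k"
          using u(1)[OF k(1)] u(2,3)[OF k(1)] k(1) b D_iff[OF k(1), of "u ?k"]
          by (simp flip: m_assoc)
        then show "(?s \<otimes>\<^bsub>S\<^esub> P g) l = (P ?k \<otimes>\<^bsub>S\<^esub> skew_embed G A D ?r) l"
          unfolding sP mult_embed[OF r(1) P[OF k(1)]] using k r(1) kr by (auto simp: P_def single_def)
      qed
      have Qs: "Q ?k \<otimes>\<^bsub>S\<^esub> ?s = single ?r (ginv G g)"
        using single k kh b e_D[of "ginv G ?k"] by (simp add: Q_def single_mult)
      have rQ: "skew_embed G A D ?r \<otimes>\<^bsub>S\<^esub> Q g = Q ?k \<otimes>\<^bsub>S\<^esub> ?s"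
        unfolding embed_mult[OF r(1) Q[OF g(1)]] Qs
        using r g D_iff[of "ginv G g" ?r] by (auto simp: Q_def single_def)
      show ?thesis
        unfolding sP' rQ[symmetric] using r(1) k g P Q by (intro pair.tensor_balanced) auto
    qed
    have F0: "?F g \<in> ?N" if "g \<in> arr G - ?I" for g
    proof -
      have "?s \<otimes>\<^bsub>S\<^esub> P g = \<zero>\<^bsub>S\<^esub>" using that single u by (auto simp: P_def single_mult)
      then show ?thesis using that Q by (simp add: pair.tensor_zero_left)
    qed
    have H0: "?H k \<in> ?N" if "k \<in> arr G - ?J" for k
    proof -
      have "Q k \<otimes>\<^bsub>S\<^esub> ?s = \<zero>\<^bsub>S\<^esub>" using that single e_D by (auto simp: Q_def single_mult)
      then show ?thesis using that P by (simp add: pair.tensor_zero_right)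
    qed
    have "sum ?H ?J = (\<Sum>g\<in>?I. ?H (h \<bullet>\<^bsub>G\<^esub> g))"
      by (rule sum.reindex_bij_witness[of _ "\<lambda>g. h \<bullet>\<^bsub>G\<^esub> g" "\<lambda>k. ginv G h \<bullet>\<^bsub>G\<^esub> k"])
        (use single in \<open>auto simp: comp_closed tgt_comp\<close>)
    moreover have "sum ?F (arr G) = sum ?F (arr G - ?I) + sum ?F ?I"
      "sum ?H (arr G) = sum ?H (arr G - ?J) + sum ?H ?J"
      by (rule sum.subset_diff; use finite_arr in auto)+
    ultimately have "pair.lmult_frag ?s t - pair.rmult_frag ?s t
        = sum ?F (arr G - ?I) - sum ?H (arr G - ?J) + (\<Sum>g\<in>?I. ?F g - ?H (h \<bullet>\<^bsub>G\<^esub> g))"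
      unfolding lm rm by (simp add: sum_subtractf)
    moreover have "sum ?F (arr G - ?I) \<in> ?N" "sum ?H (arr G - ?J) \<in> ?N"
      "(\<Sum>g\<in>?I. ?F g - ?H (h \<bullet>\<^bsub>G\<^esub> g)) \<in> ?N"
      by (rule pair.tensor_null_sum, erule F0 H0 I)+
    ultimately show ?case
      by (simp only: pair.tensor_null_add pair.tensor_null_diff)
  qed
  then show ?thesis
    unfolding skew_separable_def pair.separable_extension_iff[OF embed_subring]
    using t_keys one by blast
qed

lemma skew_separable_iff: "skew_separable G A D \<alpha> \<longleftrightarrow> (\<exists>c. trace_family c)"
  using separable_imp_trace_family trace_family_imp_separable by blast

end

section \<open>The isotropy group\<close>

context groupoid
begin

lemma arr_isotropy: "g \<in> arr (isotropy G x) \<longleftrightarrow> g \<in> arr G \<and> src G g = x \<and> tgt G g = x"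
  and src_isotropy [simp]: "src (isotropy G x) = src G"
  and tgt_isotropy [simp]: "tgt (isotropy G x) = tgt G"
  and comp_isotropy [simp]: "gcomp (isotropy G x) = gcomp G"
  by (simp_all add: isotropy_def)

lemma objs_isotropy:
  assumes x: "x \<in> objs G"
  shows "objs (isotropy G x) = {x}"
proof (intro equalityI subsetI)
  fix y assume "y \<in> objs (isotropy G x)"
  then have "y \<in> arr (isotropy G x)" "src G y = y" unfolding objs_def by simp_all
  then show "y \<in> {x}" by (simp add: arr_isotropy)
next
  fix y assume "y \<in> {x}"
  then show "y \<in> objs (isotropy G x)" using x unfolding objs_def by (simp add: arr_isotropy)
qed

lemma groupoid_isotropy:
  assumes x: "x \<in> objs G"
  shows "groupoid (isotropy G x)"
proof (rule groupoid.intro)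
  fix g assume g: "g \<in> arr (isotropy G x)"
  then have "ginv G g \<in> arr (isotropy G x)" by (simp add: arr_isotropy)
  then show "\<exists>h\<in>arr (isotropy G x). src (isotropy G x) h = tgt (isotropy G x) g \<and>
      tgt (isotropy G x) h = src (isotropy G x) g \<and>
      g \<bullet>\<^bsub>isotropy G x\<^esub> h = tgt (isotropy G x) g \<and> h \<bullet>\<^bsub>isotropy G x\<^esub> g = src (isotropy G x) g"
    using g by (intro bexI[of _ "ginv G g"]) (auto simp: arr_isotropy)
qed (use x in \<open>auto simp: arr_isotropy objs_isotropy comp_closed src_comp tgt_comp comp_assoc\<close>)

lemma ginv_isotropy:
  assumes x: "x \<in> objs G" and g: "g \<in> arr (isotropy G x)"
  shows "ginv (isotropy G x) g = ginv G g"
  using g by (intro groupoid.ginv_eqI[OF groupoid_isotropy[OF x]]) (auto simp: arr_isotropy)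

end

context unital_action
begin

lemma ideal_ring_simps [simp]:
  "carrier (ideal_ring A D x) = D x" "ring.add (ideal_ring A D x) = ring.add A"
  "ring.zero (ideal_ring A D x) = \<zero>" "monoid.mult (ideal_ring A D x) = monoid.mult A"
  by (simp_all add: ideal_ring_def)

lemma rng_ideal_ring:
  assumes x: "x \<in> arr G"
  shows "rng (ideal_ring A D x)"
proof (intro rng.intro rng_axioms.intro abelian_groupI)
  fix a assume "a \<in> carrier (ideal_ring A D x)"
  then have "\<ominus> a \<in> D x" "\<ominus> a \<oplus> a = \<zero>" using D_carrier[OF x] D_minus[OF x] by (auto simp: l_neg)
  then show "\<exists>b\<in>carrier (ideal_ring A D x). b \<oplus>\<^bsub>ideal_ring A D x\<^esub> a = \<zero>\<^bsub>ideal_ring A D x\<^esub>"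
    by auto
qed (use x in \<open>auto simp: D_add D_zero D_carrier D_mult_left a_ac m_assoc l_distr r_distr\<close>)

text \<open>\<open>ideal_ring\<close> differs from a mere change of carrier only in the field
  \<open>one\<close>, which the notion of ideal never reads.\<close>

lemma rng_ideal_cong:
  "rng_ideal I (ideal_ring A D x) \<longleftrightarrow> rng_ideal I (A\<lparr>carrier := D x\<rparr>)"
  "rng_ideal I ((ideal_ring A D x)\<lparr>carrier := D x\<rparr>) \<longleftrightarrow> rng_ideal I (A\<lparr>carrier := D x\<rparr>)"
  by (simp_all add: rng_ideal_def additive_subgroup_def ideal_ring_def)

lemma is_unit_idem_isotropy:
  assumes x: "x \<in> objs G" and g: "g \<in> arr (isotropy G x)"
  shows "is_unit_idem (ideal_ring A D x) D g (e g)"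
proof -
  have g': "g \<in> arr G" "tgt G g = x" using g by (auto simp: arr_isotropy)
  then have sub: "D g \<subseteq> D x" using D_subset_tgt by blast
  have "D g = {a \<otimes> e g |a. a \<in> D x}"
    using sub D_iff[OF g'(1)] D_carrier[OF obj_arr[OF x]] D_e[OF g'(1)] by (auto; metis subsetD)
  moreover have "e g \<in> D x" using sub e_D[OF g'(1)] by blast
  moreover have "\<forall>r\<in>D x. e g \<otimes> r = r \<otimes> e g"
    using e_comm[OF g'(1)] D_carrier[OF obj_arr[OF x]] by blast
  ultimately show ?thesis
    using g'(1) unfolding is_unit_idem_def rng_center_def by simp
qed

lemma unital_action_isotropy:
  assumes x: "x \<in> objs G"
  shows "unital_action (isotropy G x) (ideal_ring A D x) D \<alpha>"
proof -
  have xa: "x \<in> arr G" using x obj_arr by blast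
  have ideal: "rng_ideal (D g) (A\<lparr>carrier := D x\<rparr>)" if "g \<in> arr G" "tgt G g = x" for g
    using ideal_dom that by blast
  have "partial_action (isotropy G x) (ideal_ring A D x) D \<alpha>"
  proof (intro partial_action.intro groupoid_isotropy rng_ideal_ring x xa partial_action_axioms.intro)
    fix g h a
    assume g: "g \<in> arr (isotropy G x)" and h: "h \<in> arr (isotropy G x)"
      and a: "a \<in> D (ginv (isotropy G x) h)" "\<alpha> h a \<in> D (ginv (isotropy G x) g)"
    have "g \<bullet>\<^bsub>G\<^esub> h \<in> arr (isotropy G x)"
      using g h by (auto simp: arr_isotropy comp_closed src_comp tgt_comp)
    then show "a \<in> D (ginv (isotropy G x) (g \<bullet>\<^bsub>isotropy G x\<^esub> h)) \<and>
        \<alpha> (g \<bullet>\<^bsub>isotropy G x\<^esub> h) a = \<alpha> g (\<alpha> h a)"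
      using g h a act_comp[of g h a] x by (simp add: ginv_isotropy) (simp add: arr_isotropy)
  next
    fix y a assume "y \<in> objs (isotropy G x)" "a \<in> D y"
    then show "\<alpha> y a = a"
      using partial_action.act_obj[OF partial_action_axioms x, of a] objs_isotropy[OF x] by auto
  qed (use x ideal xa iso_bij iso_add iso_mult in
      \<open>auto simp: rng_ideal_cong ginv_isotropy arr_isotropy\<close>)
  moreover have "is_direct_sum (ideal_ring A D x) (objs (isotropy G x)) D"
    unfolding objs_isotropy[OF x] is_direct_sum_def
  proof (intro conjI ballI)
    interpret I: rng "ideal_ring A D x" by (rule rng_ideal_ring[OF xa])
    fix a assume a: "a \<in> carrier (ideal_ring A D x)"
    show "\<exists>!f. f \<in> (\<Pi>\<^sub>E i\<in>{x}. D i) \<and> a = finsum (ideal_ring A D x) f {x}"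
    proof (rule ex1I[of _ "\<lambda>i\<in>{x}. a"])
      show "(\<lambda>i\<in>{x}. a) \<in> (\<Pi>\<^sub>E i\<in>{x}. D i) \<and> a = finsum (ideal_ring A D x) (\<lambda>i\<in>{x}. a) {x}"
        using a D_carrier[OF xa] by auto
      fix f assume f: "f \<in> (\<Pi>\<^sub>E i\<in>{x}. D i) \<and> a = finsum (ideal_ring A D x) f {x}"
      then have "f x \<in> D x" by auto
      then have "a = f x" using f D_carrier[OF xa] by simp
      then show "f = (\<lambda>i\<in>{x}. a)" using f by (intro PiE_ext[of f "{x}" D]) auto
    qed
  qed (use ideal[of x] x xa in \<open>auto simp: rng_ideal_cong\<close>)
  moreover have "finite (arr (isotropy G x))"
    using finite_arr by (rule rev_finite_subset) (auto simp: arr_isotropy)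
  ultimately show ?thesis
    using is_unit_idem_isotropy[OF x] by (auto simp: unital_action_def unital_action_axioms_def)
qed

lemma finsum_ideal_ring:
  assumes "finite I" "x \<in> arr G" "f \<in> I \<rightarrow> D x"
  shows "finsum (ideal_ring A D x) f I = finsum A f I"
proof -
  interpret I: rng "ideal_ring A D x" by (rule rng_ideal_ring[OF assms(2)])
  show ?thesis
    using assms(1,3)
  proof (induction I rule: finite_induct)
    case (insert i I)
    then show ?case using D_carrier[OF assms(2)] by (auto simp: Pi_iff)
  qed simp
qed

text \<open>The trace criterion applied to a one-object groupoid, where a family is just its value
  at x. The idempotents, extended maps, sums and centrality computed inside A_x are then translated
  back to A.\<close>

lemma skew_separable_isotropy_iff:
  assumes x: "x \<in> objs G"
  shows "skew_separable (isotropy G x) (ideal_ring A D x) D \<alpha> \<longleftrightarrow>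
    (\<exists>c. c \<in> D x \<and> c \<in> rng_center A \<and> finsum A (\<lambda>h. act h c) {h \<in> arr G. src G h = x \<and> tgt G h = x} = e x)"
proof -
  have xa: "x \<in> arr G" using x obj_arr by blast
  let ?J = "{h \<in> arr G. src G h = x \<and> tgt G h = x}"
  interpret I: unital_action "isotropy G x" "ideal_ring A D x" D \<alpha>
    by (rule unital_action_isotropy[OF x])
  have e: "I.e h = e h" if "h \<in> arr (isotropy G x)" for h
    using I.is_unit_idem_unique[OF I.is_unit_idem is_unit_idem_isotropy[OF x]] that by blast
  have act: "I.act h a = act h a" if "h \<in> ?J" "a \<in> D x" for h a
  proof -
    have "h \<in> arr (isotropy G x)" "ginv G h \<in> arr (isotropy G x)" using that by (auto simp: arr_isotropy)
    then show ?thesis by (simp add: I.act_def act_def ginv_isotropy[OF x] e)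
  qed
  \<comment> \<open>An element c of A_x satisfies c r = c (r 1_x) and r c = (r 1_x) c, so commuting
    with A_x already means commuting with A.\<close>
  have center: "c \<in> rng_center (ideal_ring A D x) \<longleftrightarrow> c \<in> rng_center A" if c: "c \<in> D x" for c
  proof
    assume cc: "c \<in> rng_center (ideal_ring A D x)"
    have "c \<otimes> r = r \<otimes> c" if r: "r \<in> carrier A" for r
    proof -
      have c': "c \<in> carrier A" "c \<otimes> e x = c" using c D_iff[OF xa] by auto
      have "c \<otimes> r = c \<otimes> (r \<otimes> e x)"
        using c' r e_comm[OF xa r] m_assoc[of c "e x" r] xa by simp
      also have "\<dots> = (r \<otimes> e x) \<otimes> c"
        using cc D_e[OF xa r] by (simp add: rng_center_def)
      also have "\<dots> = r \<otimes> c" using c' r xa by (simp add: m_assoc e_comm)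
      finally show ?thesis .
    qed
    then show "c \<in> rng_center A" using c D_carrier[OF xa] by (simp add: rng_center_def)
  qed (use c D_carrier[OF xa] in \<open>simp add: rng_center_def\<close>)
  have J: "{h \<in> arr (isotropy G x). tgt (isotropy G x) h = x} = ?J" by (auto simp: arr_isotropy)
  have fin: "finite ?J" using finite_arr by simp
  have sum: "finsum (ideal_ring A D x) (\<lambda>h. I.act h (c (src (isotropy G x) h))) {h \<in> arr (isotropy G x). tgt (isotropy G x) h = x}
      = finsum A (\<lambda>h. act h (c x)) ?J" if c: "c x \<in> D x" for c
  proof -
    have actD: "act h (c x) \<in> D x" if "h \<in> ?J" for h
      using that act_closed[of h "c x"] D_subset_tgt[of h] c D_carrier[OF xa] by auto
    have "finsum (ideal_ring A D x) (\<lambda>h. I.act h (c (src (isotropy G x) h))) ?J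
        = finsum (ideal_ring A D x) (\<lambda>h. act h (c x)) ?J"
      using actD by (intro I.finsum_cong') (auto simp: act c)
    also have "\<dots> = finsum A (\<lambda>h. act h (c x)) ?J"
      using actD by (intro finsum_ideal_ring fin xa) auto
    finally show ?thesis unfolding J .
  qed
  have "I.trace_family c \<longleftrightarrow> c x \<in> D x \<and> c x \<in> rng_center A \<and> finsum A (\<lambda>h. act h (c x)) ?J = e x" for c
    unfolding I.trace_family_def objs_isotropy[OF x]
    using sum[of c] center[of "c x"] e[of x] x xa by (auto simp: arr_isotropy)
  then have "skew_separable (isotropy G x) (ideal_ring A D x) D \<alpha> \<longleftrightarrow>
      (\<exists>c. c x \<in> D x \<and> c x \<in> rng_center A \<and> finsum A (\<lambda>h. act h (c x)) ?J = e x)"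
    by (simp only: I.skew_separable_iff)
  also have "\<dots> \<longleftrightarrow> (\<exists>c. c \<in> D x \<and> c \<in> rng_center A \<and> finsum A (\<lambda>h. act h c) ?J = e x)"
  proof
    assume "\<exists>c. c \<in> D x \<and> c \<in> rng_center A \<and> finsum A (\<lambda>h. act h c) ?J = e x"
    then obtain c where "c \<in> D x \<and> c \<in> rng_center A \<and> finsum A (\<lambda>h. act h c) ?J = e x" ..
    then show "\<exists>c. c x \<in> D x \<and> c x \<in> rng_center A \<and> finsum A (\<lambda>h. act h (c x)) ?J = e x"
      by (intro exI[of _ "\<lambda>_. c"])
  qed blast
  finally show ?thesis .
qed

text \<open>Only arrows from x contribute to the trace at y, and they are the products \<tau>_y h
  with h in the isotropy group. Pulling \<open>act\<close> of \<tau>_y out of the sum leaves the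
  trace at x, namely 1_x = 1_{\<tau>_y^-1}, which it sends to 1_{\<tau>_y} = 1_y.\<close>

lemma isotropy_trace_imp_trace:
  assumes x: "x \<in> objs G" and c: "c \<in> D x" "c \<in> rng_center A"
    and trace: "finsum A (\<lambda>h. act h c) {h \<in> arr G. src G h = x \<and> tgt G h = x} = e x"
    and \<tau>: "transversal G x \<tau>" and e\<tau>: "\<And>y. y \<in> objs G \<Longrightarrow> e (ginv G (\<tau> y)) = e x \<and> e (\<tau> y) = e y"
  shows "trace_family (\<lambda>y. if y = x then c else \<zero>)"
  unfolding trace_family_def
proof (intro conjI ballI)
  fix y assume y: "y \<in> objs G"
  show "(if y = x then c else \<zero>) \<in> D y" using c y by (simp add: D_zero obj_arr)
  show "(if y = x then c else \<zero>) \<in> rng_center A" using c by (simp add: rng_center_def)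
  let ?J = "{h \<in> arr G. src G h = x \<and> tgt G h = x}"
  let ?t = "\<tau> y"
  have t: "?t \<in> arr G" "src G ?t = x" "tgt G ?t = y" using \<tau> y by (auto simp: transversal_def)
  have cc: "c \<in> carrier A" using c by (simp add: rng_center_def)
  have bij: "(\<lambda>h. ?t \<bullet>\<^bsub>G\<^esub> h) ` ?J = {g \<in> arr G. tgt G g = y \<and> src G g = x}"
  proof (intro equalityI subsetI)
    fix g assume g: "g \<in> {g \<in> arr G. tgt G g = y \<and> src G g = x}"
    then have "g = ?t \<bullet>\<^bsub>G\<^esub> (ginv G ?t \<bullet>\<^bsub>G\<^esub> g)" "ginv G ?t \<bullet>\<^bsub>G\<^esub> g \<in> ?J"
      using t by (auto simp: comp_closed src_comp tgt_comp)
    then show "g \<in> (\<lambda>h. ?t \<bullet>\<^bsub>G\<^esub> h) ` ?J" by blast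
  qed (use t in \<open>auto simp: comp_closed src_comp tgt_comp\<close>)
  have inj: "inj_on (\<lambda>h. ?t \<bullet>\<^bsub>G\<^esub> h) ?J"
    by (rule inj_on_inverseI[where g = "\<lambda>k. ginv G ?t \<bullet>\<^bsub>G\<^esub> k"]) (use t in auto)
  have "finsum A (\<lambda>g. act g (if src G g = x then c else \<zero>)) {g \<in> arr G. tgt G g = y}
      = finsum A (\<lambda>g. act g c) {g \<in> arr G. tgt G g = y \<and> src G g = x}"
    by (rule add.finprod_mono_neutral_cong_right) (use cc finite_arr in auto)
  also have "\<dots> = finsum A (\<lambda>h. act (?t \<bullet>\<^bsub>G\<^esub> h) c) ?J"
    unfolding bij[symmetric] using inj t cc by (subst finsum_reindex) (auto simp: comp_closed)
  also have "\<dots> = finsum A (\<lambda>h. act ?t (act h c)) ?J"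
  proof (rule finsum_cong')
    fix h assume "h \<in> ?J"
    then have h: "h \<in> arr G" "src G h = x" "tgt G h = x" by auto
    then have k: "?t \<bullet>\<^bsub>G\<^esub> h \<in> arr G" "tgt G (?t \<bullet>\<^bsub>G\<^esub> h) = y" using t by (auto simp: comp_closed tgt_comp)
    \<comment> \<open>The error factor is 1_{\<tau>_y} = 1_y by group type, and 1_y fixes everything
      in an ideal A_k with target y.\<close>
    have "act ?t (act h c) = act (?t \<bullet>\<^bsub>G\<^esub> h) c \<otimes> e y"
      using act_act[OF t(1) h(1) _ cc] t h k e\<tau>[OF y] cc e_comm[of ?t "act (?t \<bullet>\<^bsub>G\<^esub> h) c"] by simp
    also have "\<dots> = act (?t \<bullet>\<^bsub>G\<^esub> h) c"
      using act_closed[OF k(1) cc] D_subset_tgt[OF k(1)] k(2) D_iff[OF obj_arr[OF y]] by auto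
    finally show "act (?t \<bullet>\<^bsub>G\<^esub> h) c = act ?t (act h c)" by simp
  qed (use t cc in auto)
  also have "\<dots> = act ?t (finsum A (\<lambda>h. act h c) ?J)"
    using t cc finite_arr by (intro act_finsum[symmetric]) auto
  also have "\<dots> = e y"
    unfolding trace using t e\<tau>[OF y] act_unit[OF t(1)] by simp
  finally show "finsum A (\<lambda>g. act g (if src G g = x then c else \<zero>)) {g \<in> arr G. tgt G g = y} = e y" .
qed

text \<open>Each arrow g into x is uniquely h \<tau>_z^-1 with z = s(g) and h = g \<tau>_z in the
  isotropy group. Summing over h and z therefore recovers the trace of the given family at
  x.\<close>

lemma trace_imp_isotropy_trace:
  assumes x: "x \<in> objs G" and c: "trace_family c"
    and \<tau>: "transversal G x \<tau>" and e\<tau>: "\<And>y. y \<in> objs G \<Longrightarrow> e (ginv G (\<tau> y)) = e x \<and> e (\<tau> y) = e y"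
  defines "d \<equiv> finsum A (\<lambda>z. act (ginv G (\<tau> z)) (c z)) (objs G)"
  shows "d \<in> D x" "d \<in> rng_center A"
    "finsum A (\<lambda>h. act h d) {h \<in> arr G. src G h = x \<and> tgt G h = x} = e x"
proof -
  let ?J = "{h \<in> arr G. src G h = x \<and> tgt G h = x}"
  let ?\<sigma> = "\<lambda>z. ginv G (\<tau> z)"
  have xa: "x \<in> arr G" using x obj_arr by blast
  have t: "\<tau> z \<in> arr G" "src G (\<tau> z) = x" "tgt G (\<tau> z) = z" if "z \<in> objs G" for z
    using \<tau> that by (auto simp: transversal_def)
  have c: "c z \<in> D z" "c z \<in> rng_center A" "c z \<in> carrier A" if "z \<in> objs G" for z
    using c that by (auto simp: trace_family_def rng_center_def)
  have trace: "finsum A (\<lambda>g. act g (c (src G g))) {g \<in> arr G. tgt G g = x} = e x"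
    using assms(2) x by (auto simp: trace_family_def)
  have cl: "act (?\<sigma> z) (c z) \<in> D x" "act (?\<sigma> z) (c z) \<in> carrier A" if "z \<in> objs G" for z
    using act_closed[of "?\<sigma> z" "c z"] D_subset_tgt[of "?\<sigma> z"] t[OF that] c[OF that] by auto
  show "d \<in> D x" unfolding d_def using cl by (intro D_finsum xa) auto
  show "d \<in> rng_center A"
    unfolding rng_center_def
  proof (intro CollectI conjI ballI)
    show dc: "d \<in> carrier A" unfolding d_def using cl by (intro finsum_closed) auto
    fix r assume r: "r \<in> carrier A"
    have "d \<otimes> r = finsum A (\<lambda>z. act (?\<sigma> z) (c z) \<otimes> r) (objs G)"
      unfolding d_def using cl r by (intro finsum_ldistr) auto
    also have "\<dots> = finsum A (\<lambda>z. r \<otimes> act (?\<sigma> z) (c z)) (objs G)"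
      using act_center[OF ginv_closed[OF t(1)] c(2)] r cl
      by (intro finsum_cong') (auto simp: rng_center_def intro!: m_closed)
    also have "\<dots> = r \<otimes> d"
      unfolding d_def using cl r by (intro finsum_rdistr[symmetric]) auto
    finally show "d \<otimes> r = r \<otimes> d" .
  qed
  \<comment> \<open>The composition law leaves a factor 1_h. To remove it, g = h \<tau>_z^-1 is
    composed with \<tau>_z: group type gives c_z = act \<tau>_z (act \<tau>_z^-1 c_z), so act g c_z
    equals 1_g act h (act \<tau>_z^-1 c_z), on which 1_h acts trivially.\<close>
  have key: "act h (act (?\<sigma> z) (c z)) = act (h \<bullet>\<^bsub>G\<^esub> ?\<sigma> z) (c z)" if h: "h \<in> ?J" and z: "z \<in> objs G" for h z
  proof -
    let ?g = "h \<bullet>\<^bsub>G\<^esub> ?\<sigma> z"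
    have g: "?g \<in> arr G" "src G ?g = z" "tgt G ?g = x" "?g \<bullet>\<^bsub>G\<^esub> \<tau> z = h"
      using h t[OF z] by (auto simp: comp_closed src_comp tgt_comp)
    have za: "z \<in> arr G" using z obj_arr by blast
    have cz: "e z \<otimes> c z = c z" using c[OF z] za D_iff[OF za] e_comm[OF za] by simp
    have "act (\<tau> z) (act (?\<sigma> z) (c z)) = e (\<tau> z) \<otimes> (c z \<otimes> e z)"
      using act_act[of "\<tau> z" "?\<sigma> z" "c z"] t[OF z] c[OF z] z by simp
    also have "\<dots> = c z" using e\<tau>[OF z] cz c[OF z] za D_iff[OF za] by simp
    finally have "act ?g (c z) = act ?g (act (\<tau> z) (act (?\<sigma> z) (c z)))" by simp
    also have "\<dots> = e ?g \<otimes> act h (act (?\<sigma> z) (c z))"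
      using act_act[of ?g "\<tau> z"] g t[OF z] cl[OF z] by simp
    also have "act h (act (?\<sigma> z) (c z)) = e h \<otimes> act ?g (c z)"
      using act_act[of h "?\<sigma> z"] h t[OF z] c[OF z] by simp
    also have "e ?g \<otimes> (e h \<otimes> act ?g (c z)) = e h \<otimes> act ?g (c z)"
    proof -
      have "e ?g \<otimes> (e h \<otimes> act ?g (c z)) = (e h \<otimes> e ?g) \<otimes> act ?g (c z)"
        using g(1) h c[OF z] e_comm[of ?g "e h"] m_assoc[of "e ?g" "e h" "act ?g (c z)"] by simp
      also have "\<dots> = e h \<otimes> (e ?g \<otimes> act ?g (c z))"
        using g(1) h c[OF z] by (intro m_assoc) auto
      finally show ?thesis using g(1) c[OF z] by simp
    qed
    also have "\<dots> = act h (act (?\<sigma> z) (c z))"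
      using act_act[of h "?\<sigma> z"] h t[OF z] c[OF z] by simp
    finally show ?thesis by simp
  qed
  let ?m = "\<lambda>(h, z). h \<bullet>\<^bsub>G\<^esub> ?\<sigma> z"
  have bij: "?m ` (?J \<times> objs G) = {g \<in> arr G. tgt G g = x}"
  proof (intro equalityI subsetI)
    fix g assume g: "g \<in> {g \<in> arr G. tgt G g = x}"
    then have s: "src G g \<in> objs G" using src_obj by auto
    have "g = ?m (g \<bullet>\<^bsub>G\<^esub> \<tau> (src G g), src G g)" "g \<bullet>\<^bsub>G\<^esub> \<tau> (src G g) \<in> ?J"
      using g t[OF s] by (auto simp: comp_closed src_comp tgt_comp)
    with s show "g \<in> ?m ` (?J \<times> objs G)" by blast
  qed (use t in \<open>auto simp: comp_closed src_comp tgt_comp\<close>)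
  have inj: "inj_on ?m (?J \<times> objs G)"
    by (rule inj_on_inverseI[where g = "\<lambda>g. (g \<bullet>\<^bsub>G\<^esub> \<tau> (src G g), src G g)"])
      (use t in \<open>auto simp: comp_closed src_comp tgt_comp\<close>)
  have "finsum A (\<lambda>h. act h d) ?J = finsum A (\<lambda>h. finsum A (\<lambda>z. act (h \<bullet>\<^bsub>G\<^esub> ?\<sigma> z) (c z)) (objs G)) ?J"
  proof (rule finsum_cong')
    fix h assume h: "h \<in> ?J"
    then have "act h d = finsum A (\<lambda>z. act h (act (?\<sigma> z) (c z))) (objs G)"
      unfolding d_def using cl by (intro act_finsum) auto
    also have "\<dots> = finsum A (\<lambda>z. act (h \<bullet>\<^bsub>G\<^esub> ?\<sigma> z) (c z)) (objs G)"
      using h t c by (intro finsum_cong') (auto simp: key comp_closed)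
    finally show "act h d = finsum A (\<lambda>z. act (h \<bullet>\<^bsub>G\<^esub> ?\<sigma> z) (c z)) (objs G)" .
  qed (use t c in \<open>auto simp: comp_closed intro!: finsum_closed\<close>)
  also have "\<dots> = finsum A (\<lambda>(h, z). act (h \<bullet>\<^bsub>G\<^esub> ?\<sigma> z) (c z)) (?J \<times> objs G)"
    using finite_arr t c by (intro finsum_Times[symmetric]) (auto simp: comp_closed)
  also have "\<dots> = finsum A (\<lambda>p. act (?m p) (c (src G (?m p)))) (?J \<times> objs G)"
    using t c by (intro finsum_cong') (auto simp: comp_closed src_comp)
  also have "\<dots> = finsum A (\<lambda>g. act g (c (src G g))) (?m ` (?J \<times> objs G))"
  proof (rule finsum_reindex[symmetric, OF _ inj])
    show "(\<lambda>g. act g (c (src G g))) \<in> ?m ` (?J \<times> objs G) \<rightarrow> carrier A"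
      unfolding bij using c src_obj by auto
  qed
  also have "\<dots> = e x" unfolding bij by (rule trace)
  finally show "finsum A (\<lambda>h. act h d) ?J = e x" .
qed

end

theorem theorem5p5:
  fixes G :: "('g, 'm) groupoid_data_scheme" and A :: "('a, 'n) ring_scheme"
    and D :: "'g \<Rightarrow> 'a set" and \<alpha> :: "'g \<Rightarrow> 'a \<Rightarrow> 'a"
    and x :: 'g and \<tau> :: "'g \<Rightarrow> 'g"
  assumes "groupoid G" and "finite (arr G)" and "connected_groupoid G"
    and "x \<in> objs G"
    and "rng A" and "is_direct_sum A (objs G) D"
    and "unital_partial_action G A D \<alpha>" and "group_type G D"
    and "transversal G x \<tau>"
    and "\<forall>y\<in>objs G. D (ginv G (\<tau> y)) = D x \<and> D (\<tau> y) = D y"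
  shows
    "(skew_separable (isotropy G x) (ideal_ring A D x) D \<alpha> \<and>
      (\<exists>a\<in>rng_center A.
         finsum A (\<lambda>z. \<alpha> (ginv G (\<tau> z)) (a \<otimes>\<^bsub>A\<^esub> unit_idem A D z)) (objs G) = unit_idem A D x)
      \<longrightarrow> skew_separable G A D \<alpha>)
     \<and>
     (skew_separable G A D \<alpha> \<longrightarrow> skew_separable (isotropy G x) (ideal_ring A D x) D \<alpha>)"
proof -
  interpret unital_action G A D \<alpha>
    using assms(2,6,7)
    by (simp add: unital_action_def unital_action_axioms_def unital_partial_action_def)
  \<comment> \<open>\<open>unit_idem\<close> depends on an arrow only through its ideal, so the
    equalities of ideals become equalities of idempotents.\<close>
  have e\<tau>: "e (ginv G (\<tau> y)) = e x \<and> e (\<tau> y) = e y" if "y \<in> objs G" for y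
    using assms(10) that by (simp add: unit_idem_def is_unit_idem_def)
  note iso_iff = skew_separable_isotropy_iff[OF assms(4)]
  have i: "skew_separable G A D \<alpha>" if iso: "skew_separable (isotropy G x) (ideal_ring A D x) D \<alpha>"
  proof -
    obtain c where "c \<in> D x" "c \<in> rng_center A"
      "finsum A (\<lambda>h. act h c) {h \<in> arr G. src G h = x \<and> tgt G h = x} = e x"
      using iso unfolding iso_iff by (elim exE conjE)
    from isotropy_trace_imp_trace[OF assms(4) this assms(9) e\<tau>] show ?thesis
      unfolding skew_separable_iff by (intro exI)
  qed
  have ii: "skew_separable (isotropy G x) (ideal_ring A D x) D \<alpha>" if sep: "skew_separable G A D \<alpha>"
  proof -
    obtain c where "trace_family c" using sep unfolding skew_separable_iff by (elim exE)
    from trace_imp_isotropy_trace[OF assms(4) this assms(9) e\<tau>] show ?thesis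
      unfolding iso_iff by (intro exI conjI)
  qed
  show ?thesis
  proof (intro conjI impI)
    assume "skew_separable G A D \<alpha>"
    then show "skew_separable (isotropy G x) (ideal_ring A D x) D \<alpha>" by (rule ii)
  qed (elim conjE, rule i)
qed

end
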